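(* Let $\mathcal{H}$ be a Hilbert space of dimension $d$. Consider the two-sample quantum universal hypothesis testing problem: for unknown $\rho,\sigma\in\mathcal{D}(\mathcal{H})$ one is given $\sigma^{\otimes m}\otimes\rho^{\otimes n}$ and must test $H_0:\sigma=\rho$ against $H_1:\sigma\neq\rho$. Let $\alpha\in(0,1)$, $k=\min\{m,n\}$, and let $m,n\to\infty$ at the same rate (i.e. along pairs with $m/n$ and $n/m$ bounded). Allowing arbitrary (possibly entangled) measurements, there exist decision rules $M$ (depending only on $m,n,\alpha,d$) such that for all sufficiently large $m,n$: whenever $\sigma=\rho$ (for any $\rho\in\mathcal{D}(\mathcal{H})$) the probability of declaring $H_1$ is at most $\alpha$; and for every fixed pair $\rho\neq\sigma$ there is a constant $K$ such that, for all sufficiently large $m,n$, the probability $\beta$ of declaring $H_0$ satisfies $$\beta\le\exp\!\left(-\frac{k\|\rho-\sigma\|_1^2}{8}+K k^{1/2}\right).$$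
   Context: $\mathcal{D}(\mathcal{H})$ denotes the set of density operators on $\mathcal{H}$. A decision rule is a two-outcome POVM $\{E_0,E_1\}$ on $\mathcal{H}^{\otimes(m+n)}$ (outcome $0$: declare $H_0$; outcome $1$: declare $H_1$), not depending on the unknown states. The probability of declaring $H_0$ is $\mathrm{Tr}[(\sigma^{\otimes m}\otimes\rho^{\otimes n})E_0]$. $\|X\|_1=\mathrm{Tr}\sqrt{X^\dagger X}$ is the trace norm. *)

theory Defs
  imports Complex_Main "Jordan_Normal_Form.Matrix"
begin

definition mtrace :: "complex mat \<Rightarrow> complex" where
  "mtrace A = (\<Sum>i<dim_row A. A $$ (i, i))"

definition adj :: "complex mat \<Rightarrow> complex mat" where
  "adj A = mat (dim_col A) (dim_row A) (\<lambda>(i, j). cnj (A $$ (j, i)))"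

definition psd :: "nat \<Rightarrow> complex mat \<Rightarrow> bool" where
  "psd n A \<longleftrightarrow> A \<in> carrier_mat n n \<and> adj A = A \<and>
     (\<forall>v \<in> carrier_vec n. 0 \<le> Re (conjugate v \<bullet> (A *\<^sub>v v)))"

definition density :: "nat \<Rightarrow> complex mat \<Rightarrow> bool" where
  "density d \<rho> \<longleftrightarrow> psd d \<rho> \<and> mtrace \<rho> = 1"

definition kron :: "complex mat \<Rightarrow> complex mat \<Rightarrow> complex mat" where
  "kron A B = mat (dim_row A * dim_row B) (dim_col A * dim_col B)
     (\<lambda>(i, j). A $$ (i div dim_row B, j div dim_col B) * B $$ (i mod dim_row B, j mod dim_col B))"

fun tpow :: "complex mat \<Rightarrow> nat \<Rightarrow> complex mat" where
  "tpow A 0 = 1\<^sub>m 1"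
| "tpow A (Suc k) = kron A (tpow A k)"

definition psd_sqrt :: "complex mat \<Rightarrow> complex mat" where
  "psd_sqrt A = (THE B. psd (dim_row A) B \<and> B * B = A)"

definition trace_norm :: "complex mat \<Rightarrow> real" where
  "trace_norm X = Re (mtrace (psd_sqrt (adj X * X)))"

definition povm2 :: "nat \<Rightarrow> complex mat \<Rightarrow> complex mat \<Rightarrow> bool" where
  "povm2 N E0 E1 \<longleftrightarrow> psd N E0 \<and> psd N E1 \<and> E0 + E1 = 1\<^sub>m N"

end

(* For an orthogonal projector P and a real c put k = min m n and let V(P, c) be the product operator
   exp (- k c^2 / 4) (1 - P + e^(k c / m) P)^(tensor m) (tensor) (1 - P + e^(- k c / n) P)^(tensor n).
   By Hoeffding's bound for Bernoulli moment generating functions V(P, c) has expectation at most 1 in every state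
   with sigma = rho, so it behaves like a likelihood ratio.  Let W be the sum of the first k + 1 members of a
   countable dense family of such operators and kappa = (k + 1) / alpha.  The test
   E_0 = kappa (kappa + W)^(-1) satisfies E_1 <= W / kappa, which bounds the first error by alpha, and
   E_0 <= kappa V(P, c)^(-1) for each member of the family, since inversion reverses the operator order.
   As V(P, c)^(-1) is again a product operator, the second error is at most kappa r^k with
   r = e^(c^2/4) (1 - p + p e^(-c)) (1 - q + q e^c), p = tr (sigma P), q = tr (rho P).
   For the Helstrom projector and c = p - q = ||rho - sigma||_1 / 2 =: D the strict form of Hoeffding's bound gives
   r < e^(- D^2 / 2); by density some member of the family also satisfies this, and the strict inequality
   absorbs the factor kappa, so that K = 0 suffices. *)

theory Submission
  imports Defs "Jordan_Normal_Form.Spectral_Radius" "HOL-Analysis.Convex" "HOL-Library.Countable"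
begin

section \<open>Adjoints, traces and positive semidefinite matrices\<close>

lemma adj_carrier [simp]: "A \<in> carrier_mat m n \<Longrightarrow> adj A \<in> carrier_mat n m"
  by (auto simp: adj_def)

lemma adj_dim [simp]: "dim_row (adj A) = dim_col A" "dim_col (adj A) = dim_row A"
  by (auto simp: adj_def)

lemma adj_index [simp]: "i < dim_col A \<Longrightarrow> j < dim_row A \<Longrightarrow> adj A $$ (i, j) = cnj (A $$ (j, i))"
  by (auto simp: adj_def)

lemma adj_adj [simp]: "adj (adj A) = A"
  by (rule eq_matI) auto

lemma adj_one [simp]: "adj (1\<^sub>m n) = 1\<^sub>m n"
  by (rule eq_matI) auto

lemma adj_mult: "A \<in> carrier_mat m n \<Longrightarrow> B \<in> carrier_mat n k \<Longrightarrow> adj (A * B) = adj B * adj A"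
  by (rule eq_matI) (auto simp: scalar_prod_def intro!: sum.cong)

lemma adj_add: "A \<in> carrier_mat m n \<Longrightarrow> B \<in> carrier_mat m n \<Longrightarrow> adj (A + B) = adj A + adj B"
  by (rule eq_matI) auto

lemma adj_minus: "A \<in> carrier_mat m n \<Longrightarrow> B \<in> carrier_mat m n \<Longrightarrow> adj (A - B) = adj A - adj B"
  by (rule eq_matI) auto

lemma adj_smult: "adj (c \<cdot>\<^sub>m A) = cnj c \<cdot>\<^sub>m adj A"
  by (rule eq_matI) auto

lemma psd_carrier: "psd n A \<Longrightarrow> A \<in> carrier_mat n n"
  by (simp add: psd_def)

lemma psd_adj: "psd n A \<Longrightarrow> adj A = A"
  by (simp add: psd_def)

lemma conjugate_scalar_prod_adj:
  assumes "A \<in> carrier_mat m n" "v \<in> carrier_vec m" "w \<in> carrier_vec n"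
  shows "conjugate v \<bullet> (A *\<^sub>v w) = conjugate (adj A *\<^sub>v v) \<bullet> w"
proof -
  have "conjugate v \<bullet> (A *\<^sub>v w) = (\<Sum>i<m. \<Sum>j<n. cnj (v $ i) * (A $$ (i,j) * w $ j))"
    using assms by (auto simp: scalar_prod_def lessThan_atLeast0 sum_distrib_left intro!: sum.cong)
  also have "\<dots> = (\<Sum>j<n. \<Sum>i<m. cnj (v $ i) * (A $$ (i,j) * w $ j))"
    by (rule sum.swap)
  also have "\<dots> = conjugate (adj A *\<^sub>v v) \<bullet> w"
    using assms
    by (auto simp: scalar_prod_def lessThan_atLeast0 sum_distrib_left sum_distrib_right mult_ac intro!: sum.cong)
  finally show ?thesis .
qed

lemma conjugate_scalar_prod_self:
  fixes v :: "complex vec"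
  shows "conjugate v \<bullet> v = of_real (\<Sum>i<dim_vec v. (cmod (v $ i))\<^sup>2)"
  by (auto simp: scalar_prod_def lessThan_atLeast0 complex_norm_square mult.commute simp del: of_real_power intro!: sum.cong)

lemma psd_gram:
  assumes "G \<in> carrier_mat m n"
  shows "psd n (adj G * G)"
  unfolding psd_def
proof (intro conjI ballI)
  show "adj G * G \<in> carrier_mat n n" using assms by (simp add: mult_carrier_mat[of _ n m])
  show "adj (adj G * G) = adj G * G"
    using assms by (simp add: adj_mult[of _ n m _ n])
  fix v :: "complex vec" assume v: "v \<in> carrier_vec n"
  have "conjugate v \<bullet> (adj G * G *\<^sub>v v) = conjugate v \<bullet> (adj G *\<^sub>v (G *\<^sub>v v))"
    using assms v by (simp add: assoc_mult_mat_vec[of _ n m _ n])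
  also have "\<dots> = conjugate (G *\<^sub>v v) \<bullet> (G *\<^sub>v v)"
    using assms v by (simp add: conjugate_scalar_prod_adj[of _ n m])
  also have "\<dots> = of_real (\<Sum>i<m. (cmod ((G *\<^sub>v v) $ i))\<^sup>2)"
    using assms by (simp add: conjugate_scalar_prod_self)
  finally show "0 \<le> Re (conjugate v \<bullet> (adj G * G *\<^sub>v v))"
    by (simp add: sum_nonneg)
qed

lemma psd_add:
  assumes "psd n A" "psd n B"
  shows "psd n (A + B)"
  unfolding psd_def
proof (intro conjI ballI)
  note [simp] = psd_carrier[OF assms(1)] psd_carrier[OF assms(2)]
  show "A + B \<in> carrier_mat n n" by simp
  show "adj (A + B) = A + B" using assms by (simp add: adj_add[of _ n n] psd_adj)
  fix v :: "complex vec" assume v [simp]: "v \<in> carrier_vec n"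
  have "conjugate v \<bullet> ((A + B) *\<^sub>v v) = conjugate v \<bullet> (A *\<^sub>v v) + conjugate v \<bullet> (B *\<^sub>v v)"
    by (simp add: add_mult_distrib_mat_vec[of _ n n] scalar_prod_add_distrib[of _ n] mult_mat_vec_carrier[of _ n n])
  then show "0 \<le> Re (conjugate v \<bullet> ((A + B) *\<^sub>v v))"
    using assms v by (simp add: psd_def)
qed

lemma psd_smult:
  assumes "psd n A" "0 \<le> c"
  shows "psd n (complex_of_real c \<cdot>\<^sub>m A)"
  unfolding psd_def
proof (intro conjI ballI)
  note [simp] = psd_carrier[OF assms(1)]
  show "complex_of_real c \<cdot>\<^sub>m A \<in> carrier_mat n n" by simp
  show "adj (complex_of_real c \<cdot>\<^sub>m A) = complex_of_real c \<cdot>\<^sub>m A"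
    using assms by (simp add: adj_smult psd_adj)
  fix v :: "complex vec" assume v [simp]: "v \<in> carrier_vec n"
  have "(complex_of_real c \<cdot>\<^sub>m A) *\<^sub>v v = complex_of_real c \<cdot>\<^sub>v (A *\<^sub>v v)"
  proof (rule eq_vecI)
    fix i assume "i < dim_vec (complex_of_real c \<cdot>\<^sub>v (A *\<^sub>v v))"
    then have i: "i < dim_row A" by simp
    then have "row A i \<in> carrier_vec n" using psd_carrier[OF assms(1)] by (auto intro: row_carrier_vec)
    then show "((complex_of_real c \<cdot>\<^sub>m A) *\<^sub>v v) $ i = (complex_of_real c \<cdot>\<^sub>v (A *\<^sub>v v)) $ i"
      using i v by (simp add: smult_scalar_prod_distrib[of _ n])
  qed simp
  then have "conjugate v \<bullet> ((complex_of_real c \<cdot>\<^sub>m A) *\<^sub>v v) = complex_of_real c * (conjugate v \<bullet> (A *\<^sub>v v))"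
    by (simp add: scalar_prod_smult_distrib[of _ n] mult_mat_vec_carrier[of _ n n])
  then show "0 \<le> Re (conjugate v \<bullet> ((complex_of_real c \<cdot>\<^sub>m A) *\<^sub>v v))"
    using assms v by (simp add: psd_def)
qed

lemma psd_diag_nonneg:
  assumes "psd n A" "i < n"
  shows "0 \<le> Re (A $$ (i, i))"
proof -
  note A = psd_carrier[OF assms(1)]
  have u: "(unit_vec n i :: complex vec) \<in> carrier_vec n" by simp
  have c: "conjugate (unit_vec n i :: complex vec) = unit_vec n i"
    by (rule eq_vecI) (auto simp: unit_vec_def)
  have "conjugate (unit_vec n i) \<bullet> (A *\<^sub>v unit_vec n i) = A $$ (i, i)"
    unfolding c using A assms(2) by simp
  then show ?thesis
    using assms(1) u unfolding psd_def by metis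
qed

lemma mtrace_psd_nonneg:
  assumes "psd n A"
  shows "0 \<le> Re (mtrace A)"
  using psd_diag_nonneg[OF assms] psd_carrier[OF assms] by (auto simp: mtrace_def intro!: sum_nonneg)

lemma mtrace_add:
  "A \<in> carrier_mat n n \<Longrightarrow> B \<in> carrier_mat n n \<Longrightarrow> mtrace (A + B) = mtrace A + mtrace B"
  by (auto simp: mtrace_def sum.distrib)

lemma mtrace_minus:
  "A \<in> carrier_mat n n \<Longrightarrow> B \<in> carrier_mat n n \<Longrightarrow> mtrace (A - B) = mtrace A - mtrace B"
  by (auto simp: mtrace_def sum_subtractf)

lemma mtrace_smult: "A \<in> carrier_mat n n \<Longrightarrow> mtrace (c \<cdot>\<^sub>m A) = c * mtrace A"
  by (auto simp: mtrace_def sum_distrib_left)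

lemma mtrace_adj: "A \<in> carrier_mat n n \<Longrightarrow> mtrace (adj A) = cnj (mtrace A)"
  by (auto simp: mtrace_def)

lemma mtrace_mult_expand:
  assumes "A \<in> carrier_mat m n" "B \<in> carrier_mat n m"
  shows "mtrace (A * B) = (\<Sum>i<m. \<Sum>j<n. A $$ (i,j) * B $$ (j,i))"
  using assms by (auto simp: mtrace_def scalar_prod_def lessThan_atLeast0 intro!: sum.cong)

lemma mtrace_commute:
  assumes "A \<in> carrier_mat m n" "B \<in> carrier_mat n m"
  shows "mtrace (A * B) = mtrace (B * A)"
  unfolding mtrace_mult_expand[OF assms] mtrace_mult_expand[OF assms(2,1)]
  by (subst sum.swap) (simp add: mult.commute)

lemma mtrace_mult_real:
  assumes "A \<in> carrier_mat n n" "B \<in> carrier_mat n n" "adj A = A" "adj B = B"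
  shows "mtrace (A * B) = of_real (Re (mtrace (A * B)))"
proof -
  have "cnj (mtrace (A * B)) = mtrace (adj (A * B))"
    using assms by (simp add: mtrace_adj[of _ n])
  also have "\<dots> = mtrace (A * B)"
    using assms by (simp add: adj_mult[of _ n n _ n] mtrace_commute[of B n n])
  finally show ?thesis by (metis Reals_cnj_iff of_real_Re)
qed

section \<open>The spectral theorem\<close>

definition unitary :: "nat \<Rightarrow> complex mat \<Rightarrow> bool" where
  "unitary n U \<longleftrightarrow> U \<in> carrier_mat n n \<and> adj U * U = 1\<^sub>m n"

lemma unitary_right: "unitary n U \<Longrightarrow> U * adj U = 1\<^sub>m n"
  unfolding unitary_def using mat_mult_left_right_inverse[of "adj U" n U] by auto

lemma exists_unitary_first_col:
  fixes v :: "complex vec"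
  assumes v: "v \<in> carrier_vec n" and v0: "v \<noteq> 0\<^sub>v n"
  shows "\<exists>U c. unitary n U \<and> col U 0 = c \<cdot>\<^sub>v v"
proof -
  interpret cof_vec_space n "TYPE(complex)" .
  have n: "n \<noteq> 0" using v v0 by (auto intro!: eq_vecI)
  define b where "b = basis_completion v"
  note bc = basis_completion[OF v v0, folded b_def]
  define ws where "ws = gram_schmidt n b"
  have ws: "set ws \<subseteq> carrier_vec n" "corthogonal ws" "length ws = n"
    using gram_schmidt_result[OF bc(2,4,5) ws_def] bc(6) by auto
  obtain vs where bv: "b = v # vs" using bc(6,7) n by (cases b) auto
  have ws0: "ws ! 0 = v"
    using gram_schmidt_hd[OF v, of vs, folded bv ws_def] ws(3) n hd_conv_nth[of ws] by fastforce
  define r where "r j = sqrt (\<Sum>i<n. (cmod (ws ! j $ i))\<^sup>2)" for j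
  have wsj: "ws ! j \<in> carrier_vec n" if "j < n" for j using ws that by auto
  have cs: "ws ! j \<bullet>c ws ! j = of_real ((r j)\<^sup>2)" if "j < n" for j
  proof -
    have "ws ! j \<bullet>c ws ! j = conjugate (ws ! j) \<bullet> ws ! j"
      using wsj[OF that] by (rule conjugate_vec_sprod_comm) (rule wsj[OF that])
    also have "\<dots> = of_real ((r j)\<^sup>2)"
      using wsj[OF that] by (simp add: conjugate_scalar_prod_self r_def sum_nonneg)
    finally show ?thesis .
  qed
  have r0: "r j \<noteq> 0" if "j < n" for j
    using cs[OF that] corthogonalD[OF ws(2), of j j] ws(3) that by auto
  define U where "U = mat n n (\<lambda>(i,j). ws ! j $ i / of_real (r j))"
  have "adj U * U = 1\<^sub>m n"
  proof (rule eq_matI)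
    fix i j assume "i < dim_row (1\<^sub>m n :: complex mat)" "j < dim_col (1\<^sub>m n :: complex mat)"
    then have ij: "i < n" "j < n" by auto
    have "(adj U * U) $$ (i, j) = (\<Sum>k<n. ws ! j $ k * cnj (ws ! i $ k)) / (of_real (r i) * of_real (r j))"
      using ij by (auto simp: U_def scalar_prod_def lessThan_atLeast0 sum_divide_distrib mult_ac intro!: sum.cong)
    also have "(\<Sum>k<n. ws ! j $ k * cnj (ws ! i $ k)) = ws ! j \<bullet>c ws ! i"
      using wsj[OF ij(1)] wsj[OF ij(2)] by (auto simp: scalar_prod_def lessThan_atLeast0 intro!: sum.cong)
    also have "ws ! j \<bullet>c ws ! i / (of_real (r i) * of_real (r j)) = 1\<^sub>m n $$ (i, j)"
      using cs[of i] r0[of i] corthogonalD[OF ws(2), of j i] ws(3) ij by (auto simp: power2_eq_square)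
    finally show "(adj U * U) $$ (i, j) = 1\<^sub>m n $$ (i, j)" .
  qed (auto simp: U_def)
  then have "unitary n U" by (simp add: unitary_def U_def)
  moreover have "col U 0 = (1 / of_real (r 0)) \<cdot>\<^sub>v v"
    using n v by (intro eq_vecI) (auto simp: U_def ws0)
  ultimately show ?thesis by blast
qed

lemma unitary_mult:
  assumes "unitary n U" "unitary n V"
  shows "unitary n (U * V)"
proof -
  have c [simp]: "U \<in> carrier_mat n n" "V \<in> carrier_mat n n" using assms by (auto simp: unitary_def)
  have "adj (U * V) * (U * V) = adj V * (adj U * U) * V"
    by (simp add: adj_mult[of _ n n _ n] assoc_mult_mat[of _ n n _ n _ n] mult_carrier_mat[of _ n n])
  also have "\<dots> = 1\<^sub>m n" using assms by (simp add: unitary_def right_mult_one_mat[of _ n n])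
  finally show ?thesis by (simp add: unitary_def mult_carrier_mat[of _ n n])
qed

lemma adj_four_block:
  assumes "A \<in> carrier_mat a a" "B \<in> carrier_mat a b" "C \<in> carrier_mat b a" "D \<in> carrier_mat b b"
  shows "adj (four_block_mat A B C D) = four_block_mat (adj A) (adj C) (adj B) (adj D)"
  using assms by (intro eq_matI) auto

theorem hermitian_diagonalisable:
  assumes "A \<in> carrier_mat n n" "adj A = A"
  shows "\<exists>U l. unitary n U \<and> A = U * mat_diag n (\<lambda>i. complex_of_real (l i)) * adj U"
  using assms
proof (induction n arbitrary: A)
  case 0
  then show ?case
    by (intro exI[of _ "1\<^sub>m 0"] exI[of _ "\<lambda>_. 0"]) (auto simp: unitary_def)
next
  case (Suc n A)
  note A [simp] = Suc.prems(1)
  obtain e where "eigenvalue A e"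
    using spectrum_non_empty[OF A] by (auto simp: spectrum_def)
  then obtain v where v: "v \<in> carrier_vec (Suc n)" "v \<noteq> 0\<^sub>v (Suc n)" "A *\<^sub>v v = e \<cdot>\<^sub>v v"
    using A by (auto simp: eigenvalue_def eigenvector_def)
  obtain U c where U: "unitary (Suc n) U" and col: "col U 0 = c \<cdot>\<^sub>v v"
    using exists_unitary_first_col[OF v(1,2)] by blast
  have Uc [simp]: "U \<in> carrier_mat (Suc n) (Suc n)" using U by (simp add: unitary_def)
  define B where "B = adj U * A * U"
  have Bc [simp]: "B \<in> carrier_mat (Suc n) (Suc n)"
    by (simp add: B_def mult_carrier_mat[of _ "Suc n" "Suc n"])
  have Bh: "adj B = B"
    using Suc.prems(2) unfolding B_def
    by (simp add: adj_mult[of _ "Suc n" "Suc n" _ "Suc n"] mult_carrier_mat[of _ "Suc n" "Suc n"]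
        assoc_mult_mat[of _ "Suc n" "Suc n" _ "Suc n" _ "Suc n"])
  have "col B 0 = adj U *\<^sub>v (A *\<^sub>v col U 0)"
    unfolding B_def using A Uc
    by (simp add: mult_carrier_mat[of _ "Suc n" "Suc n"] assoc_mult_mat[of _ "Suc n" "Suc n" _ "Suc n" _ "Suc n"]
        col_mult2[of _ "Suc n" "Suc n" _ "Suc n"])
  also have "A *\<^sub>v col U 0 = e \<cdot>\<^sub>v col U 0"
    using v A by (simp add: col mult_mat_vec[of _ "Suc n" "Suc n"] smult_smult_assoc mult.commute)
  also have "adj U *\<^sub>v (e \<cdot>\<^sub>v col U 0) = e \<cdot>\<^sub>v col (adj U * U) 0"
    using Uc v(1) by (simp add: col_mult2[of _ "Suc n" "Suc n" _ "Suc n"] col mult_mat_vec[of _ "Suc n" "Suc n"])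
  finally have colB: "col B 0 = e \<cdot>\<^sub>v unit_vec (Suc n) 0"
    using U by (simp add: unitary_def)
  have B0: "B $$ (i, 0) = (if i = 0 then e else 0)" if "i < Suc n" for i
    using arg_cong[OF colB, of "\<lambda>w. w $ i"] that Bc by (auto simp: unit_vec_def)
  have Bsym: "B $$ (i, j) = cnj (B $$ (j, i))" if "i < Suc n" "j < Suc n" for i j
    using arg_cong[OF Bh, of "\<lambda>w. w $$ (i, j)"] that Bc by (auto simp del: Bh)
  have e: "e = of_real (Re e)"
    using Bsym[of 0 0] B0[of 0] by (metis Reals_cnj_iff of_real_Re zero_less_Suc)
  define D where "D = mat n n (\<lambda>(i, j). B $$ (Suc i, Suc j))"
  have D [simp]: "D \<in> carrier_mat n n" by (simp add: D_def)
  have "adj D = D"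
  proof (rule eq_matI)
    fix i j assume "i < dim_row D" "j < dim_col D"
    then show "adj D $$ (i, j) = D $$ (i, j)"
      using Bsym[of "Suc i" "Suc j"] by (simp add: D_def)
  qed (simp_all add: D_def)
  then obtain V l where V: "unitary n V" and DV: "D = V * mat_diag n (\<lambda>i. complex_of_real (l i)) * adj V"
    using Suc.IH[OF D] by blast
  have Vc [simp]: "V \<in> carrier_mat n n" using V by (simp add: unitary_def)
  have Bb: "B = four_block_mat (mat 1 1 (\<lambda>_. e)) (0\<^sub>m 1 n) (0\<^sub>m n 1) D"
  proof (rule eq_matI)
    fix i j assume "i < dim_row (four_block_mat (mat 1 1 (\<lambda>_. e)) (0\<^sub>m 1 n) (0\<^sub>m n 1) D)"
      "j < dim_col (four_block_mat (mat 1 1 (\<lambda>_. e)) (0\<^sub>m 1 n) (0\<^sub>m n 1) D)"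
    then have ij: "i < Suc n" "j < Suc n" by (auto simp: D_def)
    show "B $$ (i, j) = four_block_mat (mat 1 1 (\<lambda>_. e)) (0\<^sub>m 1 n) (0\<^sub>m n 1) D $$ (i, j)"
    proof (cases "i = 0")
      case True
      then show ?thesis using ij Bsym[of 0 j] B0[of j] B0[of 0] by (cases "j = 0") (auto simp: D_def)
    next
      case False
      then show ?thesis using ij B0[of i] by (cases "j = 0") (auto simp: D_def)
    qed
  qed (auto simp: D_def carrier_matD[OF Bc])
  define V' where "V' = four_block_mat (1\<^sub>m 1) (0\<^sub>m 1 n) (0\<^sub>m n 1) V"
  define l' where "l' i = (case i of 0 \<Rightarrow> Re e | Suc j \<Rightarrow> l j)" for i
  have V'c: "V' \<in> carrier_mat (Suc n) (Suc n)" 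
    using four_block_carrier_mat[OF one_carrier_mat[of 1] Vc] by (simp add: V'_def)
  have V'a: "adj V' = four_block_mat (1\<^sub>m 1) (0\<^sub>m 1 n) (0\<^sub>m n 1) (adj V)"
    unfolding V'_def by (subst adj_four_block[of _ 1 _ n]) (auto intro!: cong_four_block_mat)
  have "adj V' * V' = four_block_mat (1\<^sub>m 1) (0\<^sub>m 1 n) (0\<^sub>m n 1) (1\<^sub>m n)"
    unfolding V'a unfolding V'_def using V
    by (subst mult_four_block_mat[of _ 1 1 _ n _ n])
      (auto simp: unitary_def left_mult_zero_mat[OF Vc] right_mult_zero_mat[of "adj V" n n])
  then have V': "unitary (Suc n) V'" using V'c by (simp add: unitary_def)
  have dg: "mat_diag (Suc n) (\<lambda>i. complex_of_real (l' i)) =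
      four_block_mat (mat 1 1 (\<lambda>_. e)) (0\<^sub>m 1 n) (0\<^sub>m n 1) (mat_diag n (\<lambda>i. complex_of_real (l i)))"
    using e by (intro eq_matI) (auto simp: mat_diag_def l'_def split: nat.splits)
  have BV': "B = V' * mat_diag (Suc n) (\<lambda>i. complex_of_real (l' i)) * adj V'"
    unfolding Bb V'a dg unfolding V'_def
    by (simp add: mult_four_block_mat[of _ 1 1 _ n _ n _ _ 1 _ n] mult_carrier_mat[of _ n n]
        left_mult_zero_mat[of _ n n] right_mult_zero_mat[of _ n n] left_mult_zero_mat[of _ 1 1] right_mult_zero_mat[of _ 1 1]
        left_mult_one_mat[of _ 1 1] right_mult_one_mat[of _ 1 1] DV flip: One_nat_def)
  let ?L = "mat_diag (Suc n) (\<lambda>i. complex_of_real (l' i))"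
  have "A = (U * adj U) * A * (U * adj U)"
    by (simp add: unitary_right[OF U] left_mult_one_mat[OF A] right_mult_one_mat[OF A])
  also have "\<dots> = U * B * adj U"
    by (simp add: B_def mult_carrier_mat[of _ "Suc n" "Suc n"]
        assoc_mult_mat[of _ "Suc n" "Suc n" _ "Suc n" _ "Suc n"])
  also have "\<dots> = (U * V') * ?L * adj (U * V')"
    unfolding BV' using V'c
    by (simp add: mult_carrier_mat[of _ "Suc n" "Suc n"] adj_mult[of _ "Suc n" "Suc n" _ "Suc n"]
        assoc_mult_mat[of _ "Suc n" "Suc n" _ "Suc n" _ "Suc n"])
  finally show ?case
    using unitary_mult[OF U V'] by blast
qed

definition sfun :: "nat \<Rightarrow> complex mat \<Rightarrow> (nat \<Rightarrow> real) \<Rightarrow> complex mat" where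
  "sfun n U f = U * mat_diag n (\<lambda>i. complex_of_real (f i)) * adj U"

lemma sfun_carrier [simp]: "unitary n U \<Longrightarrow> sfun n U f \<in> carrier_mat n n"
  by (auto simp: sfun_def unitary_def mult_carrier_mat[of _ n n])

lemma sfun_index:
  assumes "unitary n U" "a < n" "b < n"
  shows "sfun n U f $$ (a, b) = (\<Sum>i<n. of_real (f i) * U $$ (a, i) * cnj (U $$ (b, i)))"
proof -
  have U: "U \<in> carrier_mat n n" using assms by (simp add: unitary_def)
  show ?thesis
    unfolding sfun_def mat_diag_mult_right[OF U]
    using U assms by (auto simp: scalar_prod_def lessThan_atLeast0 intro!: sum.cong)
qed

lemma sfun_cong:
  assumes "unitary n U" "\<And>i. i < n \<Longrightarrow> f i = g i"
  shows "sfun n U f = sfun n U g"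
  using assms by (intro eq_matI) (auto simp: sfun_index carrier_matD[OF sfun_carrier])

lemma sfun_mult:
  assumes "unitary n U"
  shows "sfun n U f * sfun n U g = sfun n U (\<lambda>i. f i * g i)"
proof -
  have U [simp]: "U \<in> carrier_mat n n" using assms by (simp add: unitary_def)
  let ?D = "\<lambda>f. mat_diag n (\<lambda>i. complex_of_real (f i))"
  have "sfun n U f * sfun n U g = U * ?D f * (adj U * U) * ?D g * adj U"
    by (simp add: sfun_def assoc_mult_mat[of _ n n _ n _ n] mult_carrier_mat[of _ n n])
  also have "\<dots> = U * (?D f * ?D g) * adj U"
    using assms by (simp add: unitary_def assoc_mult_mat[of _ n n _ n _ n] mult_carrier_mat[of _ n n]
        left_mult_one_mat[of _ n n])
  finally show ?thesis by (simp add: sfun_def mat_diag_diag)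
qed

lemma sfun_add:
  assumes "unitary n U"
  shows "sfun n U f + sfun n U g = sfun n U (\<lambda>i. f i + g i)"
  using assms by (intro eq_matI) (auto simp: sfun_index carrier_matD[OF sfun_carrier] sum.distrib algebra_simps)

lemma sfun_smult:
  assumes "unitary n U"
  shows "complex_of_real c \<cdot>\<^sub>m sfun n U f = sfun n U (\<lambda>i. c * f i)"
  using assms by (intro eq_matI)
    (auto simp: sfun_index carrier_matD[OF sfun_carrier] sum_distrib_left mult_ac)

lemma sfun_minus:
  assumes "unitary n U"
  shows "sfun n U f - sfun n U g = sfun n U (\<lambda>i. f i - g i)"
  using assms by (intro eq_matI) (auto simp: sfun_index carrier_matD[OF sfun_carrier] sum_subtractf algebra_simps)

lemma sfun_one:
  assumes "unitary n U"
  shows "sfun n U (\<lambda>i. 1) = 1\<^sub>m n"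
proof -
  have "mat_diag n (\<lambda>i. complex_of_real 1) = 1\<^sub>m n" by (rule eq_matI) (auto simp: mat_diag_def)
  then show ?thesis using assms unitary_right[OF assms]
    by (simp add: sfun_def unitary_def right_mult_one_mat[of _ n n])
qed

lemma sfun_zero:
  assumes "unitary n U" "\<And>i. i < n \<Longrightarrow> f i = 0"
  shows "sfun n U f = 0\<^sub>m n n"
  using assms by (intro eq_matI) (auto simp: sfun_index carrier_matD[OF sfun_carrier])

lemma adj_sfun [simp]:
  assumes "unitary n U"
  shows "adj (sfun n U f) = sfun n U f"
  using assms by (intro eq_matI) (auto simp: sfun_index carrier_matD[OF sfun_carrier] mult_ac)

lemma psd_sfun:
  assumes "unitary n U" "\<And>i. i < n \<Longrightarrow> 0 \<le> f i"
  shows "psd n (sfun n U f)"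
proof -
  have "sfun n U f = sfun n U (\<lambda>i. sqrt (f i) * sqrt (f i))"
    using assms by (intro sfun_cong) auto
  also have "\<dots> = adj (sfun n U (\<lambda>i. sqrt (f i))) * sfun n U (\<lambda>i. sqrt (f i))"
    using assms by (simp add: sfun_mult)
  finally show ?thesis using psd_gram[OF sfun_carrier] assms by metis
qed

lemma adj_mult_sfun_mult:
  assumes "unitary n U"
  shows "adj U * sfun n U f * U = mat_diag n (\<lambda>i. complex_of_real (f i))"
proof -
  have U [simp]: "U \<in> carrier_mat n n" using assms by (simp add: unitary_def)
  have "adj U * sfun n U f * U = (adj U * U) * mat_diag n (\<lambda>i. complex_of_real (f i)) * (adj U * U)"
    by (simp add: sfun_def assoc_mult_mat[of _ n n _ n _ n] mult_carrier_mat[of _ n n])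
  then show ?thesis using assms
    by (simp add: unitary_def left_mult_one_mat[of _ n n] right_mult_one_mat[of _ n n])
qed

lemma mtrace_sfun:
  assumes "unitary n U"
  shows "mtrace (sfun n U f) = of_real (\<Sum>i<n. f i)"
proof -
  have U [simp]: "U \<in> carrier_mat n n" using assms by (simp add: unitary_def)
  have "mtrace (sfun n U f) = mtrace ((U * mat_diag n (\<lambda>i. complex_of_real (f i))) * adj U)"
    by (simp add: sfun_def)
  also have "\<dots> = mtrace (adj U * (U * mat_diag n (\<lambda>i. complex_of_real (f i))))"
    by (rule mtrace_commute[of _ n n]) (auto simp: mult_carrier_mat[of _ n n])
  also have "adj U * (U * mat_diag n (\<lambda>i. complex_of_real (f i))) = mat_diag n (\<lambda>i. complex_of_real (f i))"
    using assms by (simp add: assoc_mult_mat[of _ n n _ n _ n, symmetric] unitary_def left_mult_one_mat[of _ n n])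
  finally show ?thesis by (simp add: mtrace_def mat_diag_def)
qed

lemma hermitian_sfun:
  assumes "A \<in> carrier_mat n n" "adj A = A"
  obtains U l where "unitary n U" "A = sfun n U l"
  using hermitian_diagonalisable[OF assms] unfolding sfun_def by blast

lemma psd_congr:
  assumes "psd n A" "B \<in> carrier_mat n m"
  shows "psd m (adj B * A * B)"
  unfolding psd_def
proof (intro conjI ballI)
  note [simp] = psd_carrier[OF assms(1)] assms(2)
  have AB [simp]: "A * B \<in> carrier_mat n m" by (simp add: mult_carrier_mat[of _ n n])
  have eq: "adj B * A * B = adj B * (A * B)" by (simp add: assoc_mult_mat[of _ m n _ n _ m])
  show "adj B * A * B \<in> carrier_mat m m" by (simp add: eq mult_carrier_mat[of _ m n])
  show "adj (adj B * A * B) = adj B * A * B"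
    using assms by (simp add: eq adj_mult[of _ m n _ m] adj_mult[of _ n n _ m] psd_adj)
  fix v :: "complex vec" assume v [simp]: "v \<in> carrier_vec m"
  have "conjugate v \<bullet> (adj B * A * B *\<^sub>v v) = conjugate v \<bullet> (adj B *\<^sub>v (A *\<^sub>v (B *\<^sub>v v)))"
    by (simp add: eq assoc_mult_mat_vec[of _ m n _ m] assoc_mult_mat_vec[of _ n n _ m])
  also have "\<dots> = conjugate (B *\<^sub>v v) \<bullet> (A *\<^sub>v (B *\<^sub>v v))"
    by (subst conjugate_scalar_prod_adj[of _ m n])
      (auto simp: mult_mat_vec_carrier[of _ n n] mult_mat_vec_carrier[of _ n m])
  finally show "0 \<le> Re (conjugate v \<bullet> (adj B * A * B *\<^sub>v v))"
    using assms(1) mult_mat_vec_carrier[OF assms(2) v] by (simp add: psd_def)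
qed

lemma psd_sfunE:
  assumes "psd n A"
  obtains U l where "unitary n U" "A = sfun n U l" "\<And>i. i < n \<Longrightarrow> 0 \<le> l i"
proof -
  obtain U l where U: "unitary n U" and A: "A = sfun n U l"
    using hermitian_sfun[OF psd_carrier psd_adj] assms by metis
  have "U \<in> carrier_mat n n" using U by (simp add: unitary_def)
  from psd_congr[OF assms this] have "psd n (mat_diag n (\<lambda>i. complex_of_real (l i)))"
    by (simp add: A adj_mult_sfun_mult[OF U])
  from psd_diag_nonneg[OF this] have "0 \<le> l i" if "i < n" for i
    using that by (simp add: mat_diag_def)
  with U A that show thesis by blast
qed

lemma psd_gramE:
  assumes "psd n A"
  obtains G where "G \<in> carrier_mat n n" "A = adj G * G"
proof -
  obtain U l where U: "unitary n U" and A: "A = sfun n U l" and l: "\<And>i. i < n \<Longrightarrow> 0 \<le> l i"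
    using psd_sfunE[OF assms] by metis
  have "A = sfun n U (\<lambda>i. sqrt (l i) * sqrt (l i))"
    unfolding A using U l by (intro sfun_cong) auto
  also have "\<dots> = adj (sfun n U (\<lambda>i. sqrt (l i))) * sfun n U (\<lambda>i. sqrt (l i))"
    using U by (simp add: sfun_mult)
  finally show thesis using that U sfun_carrier by metis
qed

lemma psd_trace_zero:
  assumes "psd n A" "Re (mtrace A) = 0"
  shows "A = 0\<^sub>m n n"
proof -
  obtain U l where U: "unitary n U" and A: "A = sfun n U l" and l: "\<And>i. i < n \<Longrightarrow> 0 \<le> l i"
    using psd_sfunE[OF assms(1)] by metis
  have "(\<Sum>i<n. l i) = 0" using assms(2) by (simp add: A mtrace_sfun[OF U])
  then have "\<forall>i<n. l i = 0" using l by (subst (asm) sum_nonneg_eq_0_iff) auto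
  then show ?thesis unfolding A using U by (intro sfun_zero) auto
qed

lemma mtrace_mult_psd_nonneg:
  assumes "psd n A" "psd n B"
  shows "0 \<le> Re (mtrace (A * B))"
proof -
  obtain G where G [simp]: "G \<in> carrier_mat n n" and A: "A = adj G * G"
    using psd_gramE[OF assms(1)] by metis
  note [simp] = psd_carrier[OF assms(2)]
  have "mtrace (A * B) = mtrace (adj G * (G * B))"
    by (simp add: A assoc_mult_mat[of _ n n _ n _ n])
  also have "\<dots> = mtrace ((G * B) * adj G)"
    by (rule mtrace_commute[of _ n n]) (auto simp: mult_carrier_mat[of _ n n])
  finally have "mtrace (A * B) = mtrace (adj (adj G) * B * adj G)" by simp
  then show ?thesis using mtrace_psd_nonneg[OF psd_congr[OF assms(2), of "adj G" n]] by simp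
qed

section \<open>Square roots and the trace norm\<close>

text \<open>With \<open>D = B - C\<close> one has \<open>B D + D C = 0\<close>, so the positive matrices \<open>D B D\<close> and \<open>D C D\<close>
  have opposite traces; hence both vanish, and with them their difference \<open>D ^ 3\<close>.\<close>

lemma psd_square_inject:
  assumes B: "psd n B" and C: "psd n C" and eq: "B * B = C * C"
  shows "B = C"
proof -
  note [simp] = psd_carrier[OF B] psd_carrier[OF C]
  define D where "D = B - C"
  have D [simp]: "D \<in> carrier_mat n n" using minus_carrier_mat[OF psd_carrier[OF C]] by (simp add: D_def)
  have aD: "adj D = D" using B C by (simp add: D_def adj_minus[of _ n n] psd_adj)
  have psds: "psd n (D * B * D)" "psd n (D * C * D)"
    using psd_congr[OF B D] psd_congr[OF C D] by (auto simp: aD)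
  have "B * D + D * C = 0\<^sub>m n n"
  proof -
    have "B * D = B * B - B * C" "D * C = B * C - C * C"
      by (simp_all add: D_def mult_minus_distrib_mat[of _ n n _ n] minus_mult_distrib_mat[of _ n n _ _ n])
    moreover have "M - N + (N - M) = 0\<^sub>m n n" if "M \<in> carrier_mat n n" "N \<in> carrier_mat n n" for M N :: "complex mat"
      using that by (intro eq_matI) auto
    ultimately show ?thesis using eq by (simp add: mult_carrier_mat[of _ n n])
  qed
  then have "0\<^sub>m n n = (B * D + D * C) * D"
    by (simp add: left_mult_zero_mat[OF D])
  also have "\<dots> = B * D * D + D * C * D"
    by (simp add: add_mult_distrib_mat[of _ n n _ _ n] mult_carrier_mat[of _ n n])
  finally have "mtrace (B * D * D + D * C * D) = mtrace (0\<^sub>m n n)" by (rule arg_cong[OF sym])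
  then have "mtrace (B * D * D + D * C * D) = 0" by (simp add: mtrace_def)
  moreover have "mtrace (B * D * D) = mtrace (D * B * D)"
    using mtrace_commute[of "B * D" n n D]
    by (simp add: mult_carrier_mat[of _ n n] assoc_mult_mat[of _ n n _ n _ n])
  ultimately have "Re (mtrace (D * B * D)) + Re (mtrace (D * C * D)) = 0"
    by (simp add: mtrace_add[of _ n] mult_carrier_mat[of _ n n] flip: plus_complex.sel)
  then have "D * B * D = 0\<^sub>m n n" "D * C * D = 0\<^sub>m n n"
    using psds mtrace_psd_nonneg[OF psds(1)] mtrace_psd_nonneg[OF psds(2)]
    by (auto intro!: psd_trace_zero)
  moreover have "D * D * D = D * B * D - D * C * D"
    by (subst (2) D_def)
      (simp add: mult_minus_distrib_mat[of _ n n _ n] minus_mult_distrib_mat[of _ n n _ _ n] mult_carrier_mat[of _ n n])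
  ultimately have D3: "D * D * D = 0\<^sub>m n n" by simp
  obtain U l where U: "unitary n U" and Dl: "D = sfun n U l"
    using hermitian_sfun[OF D aD] by metis
  have "sfun n U (\<lambda>i. l i * l i * l i) = 0\<^sub>m n n"
    using D3 by (simp add: Dl sfun_mult[OF U])
  then have diag: "mat_diag n (\<lambda>i. complex_of_real (l i * l i * l i)) = 0\<^sub>m n n"
    using adj_mult_sfun_mult[OF U, of "\<lambda>i. l i * l i * l i"] U
    by (simp add: unitary_def right_mult_zero_mat[of "adj U" n n] left_mult_zero_mat[of U n n])
  have "l i = 0" if "i < n" for i
    using arg_cong[OF diag, of "\<lambda>M. M $$ (i, i)"] that by (simp add: mat_diag_def)
  then have "D = 0\<^sub>m n n" unfolding Dl using U by (intro sfun_zero) auto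
  then have diff: "(B - C) $$ (i, j) = 0" if "i < n" "j < n" for i j
    using that by (simp add: D_def)
  show ?thesis
  proof (rule eq_matI)
    fix i j assume "i < dim_row C" "j < dim_col C"
    then show "B $$ (i, j) = C $$ (i, j)"
      using diff[of i j] by (simp add: carrier_matD[OF psd_carrier[OF C]])
  qed (simp_all add: carrier_matD[OF psd_carrier[OF B]] carrier_matD[OF psd_carrier[OF C]])
qed

lemma psd_sqrt_square:
  assumes "psd n B"
  shows "psd_sqrt (B * B) = B"
proof -
  have "dim_row (B * B) = n" using psd_carrier[OF assms] by simp
  then show ?thesis
    unfolding psd_sqrt_def using assms psd_square_inject by (intro the_equality) auto
qed

definition projector :: "nat \<Rightarrow> complex mat \<Rightarrow> bool" where
  "projector n P \<longleftrightarrow> P \<in> carrier_mat n n \<and> adj P = P \<and> P * P = P"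

lemma trace_norm_sfun:
  assumes U: "unitary n U"
  shows "trace_norm (sfun n U l) = (\<Sum>i<n. \<bar>l i\<bar>)"
proof -
  have "adj (sfun n U l) * sfun n U l = sfun n U (\<lambda>i. \<bar>l i\<bar>) * sfun n U (\<lambda>i. \<bar>l i\<bar>)"
    using U by (simp add: sfun_mult)
  then have "psd_sqrt (adj (sfun n U l) * sfun n U l) = sfun n U (\<lambda>i. \<bar>l i\<bar>)"
    using psd_sqrt_square[OF psd_sfun[OF U, of "\<lambda>i. \<bar>l i\<bar>"]] by simp
  then show ?thesis
    by (simp add: trace_norm_def mtrace_sfun[OF U] flip: of_real_sum)
qed

lemma trace_norm_projector:
  assumes X: "X \<in> carrier_mat n n" "adj X = X"
  obtains P where "projector n P" "trace_norm X = Re (mtrace X) - 2 * Re (mtrace (X * P))"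
proof -
  obtain U l where U: "unitary n U" and Xl: "X = sfun n U l"
    using hermitian_sfun[OF X] by metis
  define P where "P = sfun n U (\<lambda>i. if l i < 0 then 1 else 0)"
  have "P * P = P" unfolding P_def sfun_mult[OF U] by (rule sfun_cong[OF U]) auto
  then have "projector n P" using U by (simp add: projector_def P_def)
  moreover have "X * P = sfun n U (\<lambda>i. if l i < 0 then l i else 0)"
    unfolding Xl P_def sfun_mult[OF U] by (rule sfun_cong[OF U]) auto
  then have "Re (mtrace X) - 2 * Re (mtrace (X * P)) = (\<Sum>i<n. \<bar>l i\<bar>)"
    by (auto simp: Xl mtrace_sfun[OF U] sum_distrib_left simp flip: sum_subtractf intro!: sum.cong)
  ultimately show thesis using that trace_norm_sfun[OF U] Xl by simp
qed

lemma trace_norm_pos: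
  assumes X: "X \<in> carrier_mat n n" "adj X = X" "X \<noteq> 0\<^sub>m n n"
  shows "0 < trace_norm X"
proof -
  obtain U l where U: "unitary n U" and Xl: "X = sfun n U l"
    using hermitian_sfun[OF X(1,2)] by metis
  obtain i where "i < n" "l i \<noteq> 0" using X(3) sfun_zero[OF U] Xl by metis
  then show ?thesis unfolding Xl trace_norm_sfun[OF U] by (intro sum_pos2[of _ i]) auto
qed

section \<open>Tensor powers\<close>

lemma kron_carrier [simp]:
  "A \<in> carrier_mat a b \<Longrightarrow> B \<in> carrier_mat c d \<Longrightarrow> kron A B \<in> carrier_mat (a * c) (b * d)"
  by (auto simp: kron_def)

lemma sum_div_mod:
  fixes f g :: "nat \<Rightarrow> 'a :: comm_semiring_0"
  shows "(\<Sum>k<a * b. f (k div b) * g (k mod b)) = (\<Sum>i<a. f i) * (\<Sum>j<b. g j)"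
proof -
  have "(\<Sum>i<a. f i) * (\<Sum>j<b. g j) = (\<Sum>(i, j)\<in>{..<a} \<times> {..<b}. f i * g j)"
    by (simp add: sum_product sum.cartesian_product)
  also have "\<dots> = (\<Sum>k<a * b. f (k div b) * g (k mod b))"
  proof (rule sum.reindex_bij_witness[of _ "\<lambda>k. (k div b, k mod b)" "\<lambda>(i, j). i * b + j"])
    fix x assume "x \<in> {..<a} \<times> {..<b}"
    then obtain i j where x: "x = (i, j)" "i < a" "j < b" by auto
    have "i * b + j < i * b + b" using x by simp
    also have "\<dots> = (Suc i) * b" by simp
    also have "\<dots> \<le> a * b" using x by (intro mult_right_mono) auto
    finally show "(case x of (i, j) \<Rightarrow> i * b + j) \<in> {..<a * b}" using x by simp
  next
    fix k assume "k \<in> {..<a * b}"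
    then have "k < a * b" "b > 0" by (auto intro!: Nat.gr0I)
    then show "(k div b, k mod b) \<in> {..<a} \<times> {..<b}" by (auto simp: less_mult_imp_div_less)
  qed auto
  finally show ?thesis ..
qed

lemma kron_mult:
  assumes "A \<in> carrier_mat a b" "B \<in> carrier_mat a' b'" "C \<in> carrier_mat b c" "D \<in> carrier_mat b' c'"
  shows "kron A B * kron C D = kron (A * C) (B * D)"
proof (rule eq_matI)
  fix i j assume "i < dim_row (kron (A * C) (B * D))" "j < dim_col (kron (A * C) (B * D))"
  then have ij: "i < a * a'" "j < c * c'" using assms by (auto simp: kron_def)
  then have pos: "a' > 0" "c' > 0" by (auto intro!: Nat.gr0I)
  then have dm: "i div a' < a" "i mod a' < a'" "j div c' < c" "j mod c' < c'"
    using ij by (auto simp: less_mult_imp_div_less)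
  have dmk: "k div b' < b" "k mod b' < b'" if "k < b * b'" for k
  proof -
    have "b' > 0" using that by (auto intro!: Nat.gr0I)
    then show "k div b' < b" "k mod b' < b'" using that by (auto simp: less_mult_imp_div_less)
  qed
  have "(kron A B * kron C D) $$ (i, j) = (\<Sum>k<b * b'. (A $$ (i div a', k div b') * C $$ (k div b', j div c')) *
      (B $$ (i mod a', k mod b') * D $$ (k mod b', j mod c')))"
    using assms ij by (auto simp: kron_def scalar_prod_def lessThan_atLeast0 mult_ac intro!: sum.cong)
  also have "\<dots> = (\<Sum>k<b. A $$ (i div a', k) * C $$ (k, j div c')) * (\<Sum>k<b'. B $$ (i mod a', k) * D $$ (k, j mod c'))"
    by (rule sum_div_mod)
  also have "\<dots> = kron (A * C) (B * D) $$ (i, j)"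
    using assms ij dm by (simp add: kron_def scalar_prod_def lessThan_atLeast0)
  finally show "(kron A B * kron C D) $$ (i, j) = kron (A * C) (B * D) $$ (i, j)" .
qed (use assms in \<open>auto simp: kron_def\<close>)

lemma adj_kron: "adj (kron A B) = kron (adj A) (adj B)"
proof (rule eq_matI)
  fix i j assume "i < dim_row (kron (adj A) (adj B))" "j < dim_col (kron (adj A) (adj B))"
  then have ij: "i < dim_col A * dim_col B" "j < dim_row A * dim_row B" by (auto simp: kron_def)
  then have "dim_col B > 0" "dim_row B > 0" by (auto intro!: Nat.gr0I)
  then show "adj (kron A B) $$ (i, j) = kron (adj A) (adj B) $$ (i, j)"
    using ij by (simp add: kron_def less_mult_imp_div_less)
qed (auto simp: kron_def)

lemma mtrace_kron:
  assumes "A \<in> carrier_mat a a" "B \<in> carrier_mat b b"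
  shows "mtrace (kron A B) = mtrace A * mtrace B"
  using assms sum_div_mod[of "\<lambda>i. A $$ (i, i)" b "\<lambda>i. B $$ (i, i)" a] by (simp add: mtrace_def kron_def)

lemma kron_one: "kron (1\<^sub>m a) (1\<^sub>m b) = 1\<^sub>m (a * b)"
proof (rule eq_matI)
  fix i j assume "i < dim_row (1\<^sub>m (a * b) :: complex mat)" "j < dim_col (1\<^sub>m (a * b) :: complex mat)"
  then have ij: "i < a * b" "j < a * b" by auto
  then have "b > 0" by (auto intro!: Nat.gr0I)
  moreover have "i div b = j div b \<and> i mod b = j mod b \<longleftrightarrow> i = j"
    by (metis div_mult_mod_eq)
  ultimately show "kron (1\<^sub>m a) (1\<^sub>m b) $$ (i, j) = 1\<^sub>m (a * b) $$ (i, j)"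
    using ij by (auto simp: kron_def less_mult_imp_div_less)
qed (auto simp: kron_def)

lemma psd_kron:
  assumes "psd a A" "psd b B"
  shows "psd (a * b) (kron A B)"
proof -
  obtain G H where G: "G \<in> carrier_mat a a" "A = adj G * G" and H: "H \<in> carrier_mat b b" "B = adj H * H"
    using psd_gramE assms by metis
  then have "kron A B = adj (kron G H) * kron G H"
    by (simp add: adj_kron kron_mult[of _ a a _ b b _ a _ b])
  then show ?thesis using psd_gram[of "kron G H" "a * b" "a * b"] G H by simp
qed

lemma tpow_carrier [simp]: "A \<in> carrier_mat d d \<Longrightarrow> tpow A k \<in> carrier_mat (d ^ k) (d ^ k)"
  by (induction k) auto

lemma tpow_mult:
  assumes "A \<in> carrier_mat d d" "B \<in> carrier_mat d d"
  shows "tpow A k * tpow B k = tpow (A * B) k"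
proof (induction k)
  case (Suc k)
  then show ?case
    using assms by (simp add: kron_mult[of A d d "tpow A k" "d ^ k" "d ^ k" B d "tpow B k" "d ^ k"])
qed simp

lemma tpow_one: "tpow (1\<^sub>m d) k = 1\<^sub>m (d ^ k)"
  by (induction k) (auto simp: kron_one)

lemma mtrace_tpow: "A \<in> carrier_mat d d \<Longrightarrow> mtrace (tpow A k) = mtrace A ^ k"
proof (induction k)
  case (Suc k)
  then show ?case by (simp add: mtrace_kron[of A d "tpow A k" "d ^ k"])
qed (simp add: mtrace_def)

lemma psd_tpow: "psd d A \<Longrightarrow> psd (d ^ k) (tpow A k)"
proof (induction k)
  case 0
  show ?case using psd_gram[of "1\<^sub>m 1" 1 1] by simp
qed (simp add: psd_kron)

section \<open>Bernoulli moment generating functions\<close>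

lemma one_minus_exp_less:
  fixes x :: real
  assumes "0 < x"
  shows "1 - exp (- (x / 2)) < x / 4 * (1 + exp (- (x / 2)))"
proof -
  define h where "h x = x / 4 * (1 + exp (- (x / 2))) - 1 + exp (- (x / 2))" for x :: real
  have "h 0 < h x"
  proof (rule DERIV_pos_imp_increasing_open[OF assms])
    fix t :: real assume t: "0 < t" "t < x"
    have "(h has_real_derivative (1 - exp (- (t / 2)) * (1 + t / 2)) / 4) (at t)"
      unfolding h_def by (auto intro!: derivative_eq_intros simp: field_simps)
    moreover have "exp (- (t / 2)) * (1 + t / 2) < exp (- (t / 2)) * exp (t / 2)"
      using exp_lower_Taylor_quadratic[of "t / 2"] t
      by (intro mult_strict_left_mono) (auto intro: less_le_trans[rotated])
    then have "0 < (1 - exp (- (t / 2)) * (1 + t / 2)) / 4"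
      by (simp flip: exp_add)
    ultimately show "\<exists>y. (h has_real_derivative y) (at t) \<and> 0 < y" by blast
  next
    show "continuous_on {0..x} h" unfolding h_def by (auto intro!: continuous_intros)
  qed
  then show ?thesis by (simp add: h_def)
qed

lemma bernoulli_mgf_pos:
  fixes p x :: real
  assumes "0 \<le> p" "p \<le> 1"
  shows "0 < 1 - p + p * exp x"
proof (cases "p = 1")
  case False
  then show ?thesis using assms by (intro add_pos_nonneg) auto
qed simp

lemma bernoulli_mgf_less_neg:
  fixes p x :: real
  assumes p: "0 \<le> p" "p \<le> 1" and x: "0 < x"
  shows "1 - p + p * exp (- x) < exp (- p * x + x\<^sup>2 / 8)"
proof -
  define M where "M t = 1 - p + p * exp (- t)" for t
  have M0: "0 < M t" for t using bernoulli_mgf_pos[OF p, of "- t"] by (simp add: M_def)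
  define g where "g t = t\<^sup>2 / 8 - p * t - ln (M t)" for t
  have "g 0 < g x"
  proof (rule DERIV_pos_imp_increasing_open[OF x])
    fix t assume t: "0 < t" "t < x"
    have "(M has_real_derivative - p * exp (- t)) (at t)"
      unfolding M_def by (auto intro!: derivative_eq_intros)
    then have d: "(g has_real_derivative t / 4 - p + p * exp (- t) / M t) (at t)"
      unfolding g_def using M0[of t] by (auto intro!: derivative_eq_intros)
    define y where "y = exp (- (t / 2))"
    have y: "0 < y" "exp (- t) = y\<^sup>2" by (auto simp: y_def power2_eq_square simp flip: exp_add)
    have "p * (1 - p) * (1 + y)\<^sup>2 \<le> M t"
    proof -
      have "M t - p * (1 - p) * (1 + y)\<^sup>2 = (1 - p - p * y)\<^sup>2"
        by (simp add: M_def y(2) power2_eq_square algebra_simps)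
      then show ?thesis by (smt (verit) zero_le_power2)
    qed
    moreover have "1 - y < t / 4 * (1 + y)" using one_minus_exp_less[OF t(1)] by (simp add: y_def)
    ultimately have "p * (1 - p) * (1 + y)\<^sup>2 * (1 - y) < M t * (t / 4 * (1 + y))"
      using M0[of t] t y by (intro le_less_trans[OF mult_right_mono mult_strict_left_mono]) (auto simp: y_def)
    then have "(p * (1 - p) * (1 - y\<^sup>2)) * (1 + y) < (M t * (t / 4)) * (1 + y)"
      by (simp add: power2_eq_square algebra_simps)
    then have "p * (1 - p) * (1 - y\<^sup>2) < M t * (t / 4)"
      by (rule mult_right_less_imp_less) (use y in simp)
    then have "p * M t - p * y\<^sup>2 < t / 4 * M t"
      by (simp add: M_def y(2) algebra_simps power2_eq_square)
    then have "0 < t / 4 - p + p * exp (- t) / M t"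
      using M0[of t] by (simp add: field_simps y(2))
    with d show "\<exists>y. (g has_real_derivative y) (at t) \<and> 0 < y" by blast
  next
    have "continuous_on {0..x} M" unfolding M_def by (auto intro!: continuous_intros)
    then show "continuous_on {0..x} g"
      unfolding g_def using M0 by (auto intro!: continuous_intros simp: less_imp_neq[symmetric])
  qed
  then have "ln (M x) < - p * x + x\<^sup>2 / 8" by (simp add: g_def M_def)
  then have "exp (ln (M x)) < exp (- p * x + x\<^sup>2 / 8)" by (simp only: exp_less_cancel_iff)
  then show ?thesis unfolding exp_ln[OF M0] by (simp add: M_def)
qed

lemma bernoulli_mgf_less:
  fixes p x :: real
  assumes p: "0 \<le> p" "p \<le> 1" and x: "x \<noteq> 0"
  shows "1 - p + p * exp x < exp (p * x + x\<^sup>2 / 8)"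
proof (cases "x < 0")
  case True
  then show ?thesis using bernoulli_mgf_less_neg[OF p, of "- x"] by simp
next
  case False
  then have "1 - (1 - p) + (1 - p) * exp (- x) < exp (- (1 - p) * x + x\<^sup>2 / 8)"
    using p x by (intro bernoulli_mgf_less_neg) auto
  then have "exp x * (1 - (1 - p) + (1 - p) * exp (- x)) < exp x * exp (- (1 - p) * x + x\<^sup>2 / 8)"
    by (intro mult_strict_left_mono) auto
  then show ?thesis
    by (simp add: algebra_simps flip: exp_add)
qed

lemma bernoulli_mgf_le:
  fixes p x :: real
  assumes "0 \<le> p" "p \<le> 1"
  shows "1 - p + p * exp x \<le> exp (p * x + x\<^sup>2 / 8)"
  using bernoulli_mgf_less[OF assms, of x] by (cases "x = 0") auto

lemma exp_mult_le:
  fixes z \<theta> :: real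
  assumes "0 \<le> \<theta>" "\<theta> \<le> 1"
  shows "exp (\<theta> * z) \<le> 1 - \<theta> + \<theta> * exp z"
  using convex_onD[OF exp_convex, of \<theta> 0 z] assms by simp

lemma bernoulli_mgf_power_le:
  fixes p c :: real
  assumes p: "0 \<le> p" "p \<le> 1" and km: "k \<le> m"
  shows "(1 - p + p * exp (real k * c / real m)) ^ m \<le> (1 - p + p * exp c) ^ k"
proof (cases "m = 0")
  case False
  define M where "M = 1 - p + p * exp c"
  have M: "0 < M" using bernoulli_mgf_pos[OF p] by (simp add: M_def)
  define \<theta> where "\<theta> = real k / real m"
  have \<theta>: "0 \<le> \<theta>" "\<theta> \<le> 1" using km False by (auto simp: \<theta>_def field_simps)
  define L where "L = ln M"
  have L: "exp L = M" using M by (simp add: L_def)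
  have "1 - p + p * exp (\<theta> * c) = exp (\<theta> * L) * ((1 - p) * exp (\<theta> * (- L)) + p * exp (\<theta> * (c - L)))"
    by (simp add: algebra_simps flip: exp_add)
  also have "\<dots> \<le> exp (\<theta> * L) * ((1 - p) * (1 - \<theta> + \<theta> * exp (- L)) + p * (1 - \<theta> + \<theta> * exp (c - L)))"
    using p exp_mult_le[OF \<theta>, of "- L"] exp_mult_le[OF \<theta>, of "c - L"]
    by (intro mult_left_mono add_mono) auto
  also have "(1 - p) * (1 - \<theta> + \<theta> * exp (- L)) + p * (1 - \<theta> + \<theta> * exp (c - L))
      = 1 - \<theta> + \<theta> * ((1 - p + p * exp c) / M)"
    by (simp add: exp_diff exp_minus L divide_inverse algebra_simps)
  finally have "1 - p + p * exp (\<theta> * c) \<le> exp (\<theta> * L)" using M by (simp flip: M_def)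
  then have "(1 - p + p * exp (\<theta> * c)) ^ m \<le> exp (\<theta> * L) ^ m"
    using bernoulli_mgf_pos[OF p] by (intro power_mono) (auto intro: less_imp_le)
  also have "exp (\<theta> * L) ^ m = exp L ^ k"
    using False by (simp add: \<theta>_def flip: exp_of_nat_mult)
  finally show ?thesis by (simp add: L M_def \<theta>_def)
qed (use km in simp)

lemma bernoulli_product_le_one:
  fixes p c :: real
  assumes p: "0 \<le> p" "p \<le> 1" and "k \<le> m" "k \<le> n"
  shows "exp (- (real k * c\<^sup>2 / 4)) * ((1 - p + p * exp (real k * c / real m)) ^ m *
      (1 - p + p * exp (- (real k * c / real n))) ^ n) \<le> 1"
proof -
  have "(1 - p + p * exp (real k * c / real m)) ^ m \<le> exp (p * c + c\<^sup>2 / 8) ^ k"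
    using bernoulli_mgf_power_le[OF p \<open>k \<le> m\<close>, of c] bernoulli_mgf_le[OF p, of c] bernoulli_mgf_pos[OF p, of c]
    by (meson less_imp_le order_trans power_mono)
  moreover have "(1 - p + p * exp (- (real k * c / real n))) ^ n \<le> exp (- p * c + c\<^sup>2 / 8) ^ k"
    using bernoulli_mgf_power_le[OF p \<open>k \<le> n\<close>, of "- c"] bernoulli_mgf_le[OF p, of "- c"] bernoulli_mgf_pos[OF p, of "- c"]
    by (simp, meson less_imp_le order_trans power_mono)
  ultimately have "(1 - p + p * exp (real k * c / real m)) ^ m * (1 - p + p * exp (- (real k * c / real n))) ^ n
      \<le> exp (p * c + c\<^sup>2 / 8) ^ k * exp (- p * c + c\<^sup>2 / 8) ^ k"
    using bernoulli_mgf_pos[OF p] by (intro mult_mono) (auto intro: less_imp_le)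
  also have "\<dots> = exp (real k * c\<^sup>2 / 4)"
    by (simp add: algebra_simps flip: exp_of_nat_mult exp_add)
  finally show ?thesis by (simp add: exp_minus field_simps)
qed

lemma eventually_mult_power_le:
  fixes r b a :: real
  assumes "0 \<le> r" "r < b" "0 < a"
  shows "\<exists>N. \<forall>k\<ge>N. real (Suc k) / a * r ^ k \<le> b ^ k"
proof -
  have b: "0 < b" using assms by simp
  have s: "norm (r / b) < 1" using assms b by (simp add: field_simps)
  have "(\<lambda>k. real k * (r / b) ^ k + (r / b) ^ k) \<longlonglongrightarrow> 0 + 0"
    by (intro tendsto_add powser_times_n_limit_0 LIMSEQ_power_zero s)
  then have "(\<lambda>k. real (Suc k) * (r / b) ^ k) \<longlonglongrightarrow> 0" by (simp add: algebra_simps)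
  from order_tendstoD(2)[OF this assms(3)] obtain N where
    N: "\<And>k. k \<ge> N \<Longrightarrow> real (Suc k) * (r / b) ^ k < a"
    unfolding eventually_sequentially by blast
  show ?thesis
  proof (intro exI[of _ N] allI impI)
    fix k assume "N \<le> k"
    from N[OF this] show "real (Suc k) / a * r ^ k \<le> b ^ k"
      using b assms(3) by (simp add: power_divide field_simps)
  qed
qed

lemma psd_one: "psd n (1\<^sub>m n)"
  using psd_gram[of "1\<^sub>m n" n n] by simp

lemma projector_psd:
  assumes "projector n P"
  shows "psd n P" "psd n (1\<^sub>m n - P)"
proof -
  note P [simp] = assms[unfolded projector_def, THEN conjunct1]
  have "P = adj P * P" using assms by (simp add: projector_def)
  then show "psd n P" using psd_gram[OF P] by simp
  have "1\<^sub>m n - P = (1\<^sub>m n - P) * (1\<^sub>m n - P)"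
    using assms
    by (simp add: projector_def mult_minus_distrib_mat[of _ n n _ n] minus_mult_distrib_mat[of _ n n _ _ n]
        minus_carrier_mat[OF P] left_mult_one_mat[of _ n n] right_mult_one_mat[of _ n n])
      (intro eq_matI; auto)
  also have "\<dots> = adj (1\<^sub>m n - P) * (1\<^sub>m n - P)"
    using assms by (simp add: projector_def adj_minus[of _ n n])
  finally show "psd n (1\<^sub>m n - P)" using psd_gram[OF minus_carrier_mat[OF P], of "1\<^sub>m n"] by simp
qed

section \<open>Resolvent tests\<close>

definition resolvent_test :: "nat \<Rightarrow> complex mat \<Rightarrow> real \<Rightarrow> complex mat \<times> complex mat \<Rightarrow> bool" where
  "resolvent_test N W \<kappa> E \<longleftrightarrow> povm2 N (fst E) (snd E) \<and>
    (\<forall>X. psd N X \<longrightarrow> Re (mtrace (X * snd E)) \<le> Re (mtrace (X * W)) / \<kappa>) \<and>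
    (\<forall>X V V'. psd N X \<longrightarrow> psd N V \<longrightarrow> psd N V' \<longrightarrow> V * V' = 1\<^sub>m N \<longrightarrow> psd N (W - V) \<longrightarrow>
      Re (mtrace (X * fst E)) \<le> \<kappa> * Re (mtrace (X * V')))"

text \<open>The type II bound is operator antitonicity of the inverse: if \<open>M = \<kappa> + W\<close>, \<open>R\<close> is its inverse and \<open>V'\<close> that
  of \<open>V\<close>, then \<open>V' - R = (R - V') V (R - V') + R (M - V) R\<close>.\<close>

lemma resolvent_test_exists:
  assumes W: "psd N W" and kappa: "0 < \<kappa>"
  shows "\<exists>E. resolvent_test N W \<kappa> E"
proof -
  obtain U l where U: "unitary N U" and Wl: "W = sfun N U l" and l: "\<And>i. i < N \<Longrightarrow> 0 \<le> l i"
    using psd_sfunE[OF W] by metis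
  define E0 where "E0 = sfun N U (\<lambda>i. \<kappa> / (\<kappa> + l i))"
  define E1 where "E1 = sfun N U (\<lambda>i. l i / (\<kappa> + l i))"
  have nz: "\<kappa> + l i \<noteq> 0" if "i < N" for i using l[OF that] kappa by simp
  have "E0 + E1 = sfun N U (\<lambda>i. 1)"
    unfolding E0_def E1_def sfun_add[OF U] using nz
    by (intro sfun_cong[OF U]) (simp flip: add_divide_distrib)
  then have povm: "povm2 N E0 E1"
    unfolding povm2_def using U l kappa
    by (auto simp: sfun_one E0_def E1_def intro!: psd_sfun divide_nonneg_nonneg add_nonneg_nonneg)
  note c [simp] = sfun_carrier[OF U]
  have I: "Re (mtrace (X * E1)) \<le> Re (mtrace (X * W)) / \<kappa>" if X: "psd N X" for X
  proof -
    note [simp] = psd_carrier[OF X]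
    have "psd N (complex_of_real (1 / \<kappa>) \<cdot>\<^sub>m W - E1)"
      unfolding E1_def Wl sfun_smult[OF U] sfun_minus[OF U]
    proof (rule psd_sfun[OF U])
      fix i assume "i < N"
      then have "l i / (\<kappa> + l i) \<le> l i / \<kappa>" using l[of i] kappa by (intro divide_left_mono) auto
      then show "0 \<le> 1 / \<kappa> * l i - l i / (\<kappa> + l i)" by simp
    qed
    from mtrace_mult_psd_nonneg[OF X this]
    show ?thesis
      by (simp add: E1_def Wl mult_minus_distrib_mat[of _ N N _ N] mtrace_minus[of _ N] mult_carrier_mat[of _ N N]
          mult_smult_distrib[of _ N N _ N] mtrace_smult[of _ N])
  qed
  have II: "Re (mtrace (X * E0)) \<le> \<kappa> * Re (mtrace (X * V'))"
    if X: "psd N X" and V: "psd N V" and V': "psd N V'" and VV': "V * V' = 1\<^sub>m N" and Z: "psd N (W - V)"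
    for X V V'
  proof -
    note cc [simp] = psd_carrier[OF X] psd_carrier[OF V] psd_carrier[OF V'] minus_carrier_mat[OF psd_carrier[OF V]]
      minus_carrier_mat[OF psd_carrier[OF V']]
    have V'V: "V' * V = 1\<^sub>m N" using mat_mult_left_right_inverse[OF cc(2,3) VV'] .
    define R where "R = sfun N U (\<lambda>i. 1 / (\<kappa> + l i))"
    define M where "M = sfun N U (\<lambda>i. \<kappa> + l i)"
    have [simp]: "R \<in> carrier_mat N N" "M \<in> carrier_mat N N" by (simp_all add: R_def M_def)
    have MR: "M * R = 1\<^sub>m N"
      unfolding R_def M_def sfun_mult[OF U] sfun_one[OF U, symmetric]
      using nz by (intro sfun_cong[OF U]) simp
    have aR: "adj R = R" using U by (simp add: R_def)
    have "M = complex_of_real \<kappa> \<cdot>\<^sub>m 1\<^sub>m N + W"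
      unfolding M_def Wl sfun_one[OF U, symmetric] sfun_smult[OF U] sfun_add[OF U] by simp
    moreover have "A + B - C = A + (B - C)"
      if "A \<in> carrier_mat N N" "B \<in> carrier_mat N N" "C \<in> carrier_mat N N" for A B C :: "complex mat"
      using that by (intro eq_matI) auto
    ultimately have "M - V = complex_of_real \<kappa> \<cdot>\<^sub>m 1\<^sub>m N + (W - V)"
      by (simp add: psd_carrier[OF W])
    then have "psd N (M - V)" using Z kappa psd_one by (simp add: psd_add psd_smult)
    from psd_congr[OF this, of R N] have p1: "psd N (R * (M - V) * R)" by (simp add: aR)
    have "adj (R - V') = R - V'" using V' by (simp add: adj_minus[of _ N N] aR psd_adj)
    then have p2: "psd N ((R - V') * V * (R - V'))" using psd_congr[OF V, of "R - V'" N] by simp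
    have "(R - V') * V * (R - V') = (R * V - 1\<^sub>m N) * (R - V')"
      by (simp add: minus_mult_distrib_mat[of _ N N _ _ N] V'V)
    also have "\<dots> = R * V * R - R * V * V' - (R - V')"
      by (simp add: minus_mult_distrib_mat[of _ N N _ _ N] mult_minus_distrib_mat[of _ N N _ N]
          mult_carrier_mat[of _ N N] left_mult_one_mat[of _ N N])
    also have "R * V * V' = R"
      by (simp add: assoc_mult_mat[of _ N N _ N _ N] VV' right_mult_one_mat[of _ N N])
    finally have e2: "(R - V') * V * (R - V') = R * V * R - R - (R - V')" .
    have "R * (M - V) * R = R * M * R - R * V * R"
      by (simp add: minus_mult_distrib_mat[of _ N N _ _ N] mult_minus_distrib_mat[of _ N N _ N] mult_carrier_mat[of _ N N])
    also have "R * M * R = R"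
      by (simp add: assoc_mult_mat[of _ N N _ N _ N] MR right_mult_one_mat[of _ N N])
    finally have e1: "R * (M - V) * R = R - R * V * R" .
    have RVR: "R * V * R \<in> carrier_mat N N" by (simp add: mult_carrier_mat[of _ N N])
    have alg: "A - B - (B - C) + (B - A) = C - B"
      if "A \<in> carrier_mat N N" "B \<in> carrier_mat N N" "C \<in> carrier_mat N N" for A B C :: "complex mat"
      using that by (intro eq_matI) auto
    have "psd N (V' - R)"
      using psd_add[OF p2 p1] unfolding e1 e2 by (simp add: alg RVR)
    from mtrace_mult_psd_nonneg[OF X this] have "Re (mtrace (X * R)) \<le> Re (mtrace (X * V'))"
      by (simp add: mult_minus_distrib_mat[of _ N N _ N] mtrace_minus[of _ N] mult_carrier_mat[of _ N N])
    moreover have "E0 = complex_of_real \<kappa> \<cdot>\<^sub>m R"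
      unfolding E0_def R_def sfun_smult[OF U] by simp
    ultimately show ?thesis using kappa
      by (simp add: mult_smult_distrib[of _ N N _ N] mtrace_smult[of _ N] mult_carrier_mat[of _ N N])
  qed
  show ?thesis
    by (rule exI[of _ "(E0, E1)"]) (use povm I II in \<open>auto simp: resolvent_test_def\<close>)
qed

fun msum :: "nat \<Rightarrow> (nat \<Rightarrow> complex mat) \<Rightarrow> nat \<Rightarrow> complex mat" where
  "msum N F 0 = 0\<^sub>m N N"
| "msum N F (Suc j) = F j + msum N F j"

lemma psd_zero: "psd n (0\<^sub>m n n)"
proof -
  have "complex_of_real 0 \<cdot>\<^sub>m 1\<^sub>m n = 0\<^sub>m n n" by (intro eq_matI) auto
  then show ?thesis using psd_smult[OF psd_one[of n], of 0] by simp
qed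

lemma psd_msum: "(\<And>i. psd N (F i)) \<Longrightarrow> psd N (msum N F j)"
  by (induction j) (auto intro: psd_add psd_zero)

lemma psd_msum_minus:
  assumes F: "\<And>i. psd N (F i)" and "i < j"
  shows "psd N (msum N F j - F i)"
  using \<open>i < j\<close>
proof (induction j)
  case (Suc j)
  note [simp] = psd_carrier[OF F] psd_carrier[OF psd_msum[OF F]]
  show ?case
  proof (cases "i = j")
    case True
    have "A + B - A = B" if "A \<in> carrier_mat N N" "B \<in> carrier_mat N N" for A B :: "complex mat"
      using that by (intro eq_matI) auto
    then show ?thesis using True psd_msum[OF F] by simp
  next
    case False
    have "A + B - C = A + (B - C)" if "A \<in> carrier_mat N N" "B \<in> carrier_mat N N" "C \<in> carrier_mat N N"
      for A B C :: "complex mat"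
      using that by (intro eq_matI) auto
    then show ?thesis using False Suc psd_add[OF F Suc.IH] by simp
  qed
qed simp

lemma mtrace_msum:
  assumes "X \<in> carrier_mat N N" "\<And>i. F i \<in> carrier_mat N N"
  shows "mtrace (X * msum N F j) = (\<Sum>i<j. mtrace (X * F i))"
proof -
  have [simp]: "msum N F j \<in> carrier_mat N N" for j using assms by (induction j) auto
  show ?thesis
  proof (induction j)
    case 0
    then show ?case using assms by (simp add: right_mult_zero_mat[of _ N N]) (simp add: mtrace_def)
  next
    case (Suc j)
    then show ?case using assms
      by (simp add: mult_add_distrib_mat[of _ N N _ N] mtrace_add[of _ N] mult_carrier_mat[of _ N N])
  qed
qed

section \<open>Tilted operators\<close>

definition tilt :: "nat \<Rightarrow> complex mat \<Rightarrow> real \<Rightarrow> complex mat" where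
  "tilt d P t = (1\<^sub>m d - P) + complex_of_real (exp t) \<cdot>\<^sub>m P"

lemma psd_tilt: "projector d P \<Longrightarrow> psd d (tilt d P t)"
  unfolding tilt_def using projector_psd by (auto intro!: psd_add psd_smult)

lemma tilt_inverse:
  assumes "projector d P"
  shows "tilt d P t * tilt d P (- t) = 1\<^sub>m d"
proof -
  have P [simp]: "P \<in> carrier_mat d d" "P * P = P" using assms by (auto simp: projector_def)
  have [simp]: "1\<^sub>m d - P \<in> carrier_mat d d" using minus_carrier_mat[OF P(1)] .
  have z: "P - P = 0\<^sub>m d d" by (intro eq_matI) (auto simp: carrier_matD[OF P(1)])
  have mz: "A - 0\<^sub>m d d = A" if "A \<in> carrier_mat d d" for A :: "complex mat"
    using that by (intro eq_matI) auto
  have Q: "(1\<^sub>m d - P) * P = 0\<^sub>m d d" "P * (1\<^sub>m d - P) = 0\<^sub>m d d" "(1\<^sub>m d - P) * (1\<^sub>m d - P) = 1\<^sub>m d - P"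
    by (simp_all add: mult_minus_distrib_mat[of _ d d _ d] minus_mult_distrib_mat[of _ d d _ _ d]
        left_mult_one_mat[of _ d d] right_mult_one_mat[of _ d d] z mz)
  have "tilt d P t * tilt d P (- t) = (1\<^sub>m d - P) + complex_of_real (exp t * exp (- t)) \<cdot>\<^sub>m P"
    unfolding tilt_def
    by (simp add: mult_add_distrib_mat[of _ d d _ d] add_mult_distrib_mat[of _ d d _ _ d] mult_carrier_mat[of _ d d]
        mult_smult_distrib[of _ d d _ d] mult_smult_assoc_mat[of _ d d _ d] Q)
      (intro eq_matI; auto simp: algebra_simps)
  also have "\<dots> = 1\<^sub>m d"
    unfolding exp_minus_inverse by (intro eq_matI) (auto simp: carrier_matD[OF P(1)])
  finally show ?thesis .
qed

lemma mtrace_density_tilt: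
  assumes "density d \<rho>" "projector d P"
  defines "p \<equiv> Re (mtrace (\<rho> * P))"
  shows "mtrace (\<rho> * tilt d P t) = complex_of_real (1 - p + p * exp t)"
proof -
  have r [simp]: "\<rho> \<in> carrier_mat d d" and tr: "mtrace \<rho> = 1" and ar: "adj \<rho> = \<rho>"
    using assms(1) by (auto simp: density_def psd_def)
  have P [simp]: "P \<in> carrier_mat d d" and aP: "adj P = P" using assms(2) by (auto simp: projector_def)
  have [simp]: "1\<^sub>m d - P \<in> carrier_mat d d" using minus_carrier_mat[OF P] .
  have p: "mtrace (\<rho> * P) = complex_of_real p"
    unfolding p_def by (rule mtrace_mult_real[OF r P ar aP])
  show ?thesis
    unfolding tilt_def
    by (simp add: mult_add_distrib_mat[of _ d d _ d] mult_carrier_mat[of _ d d] mult_minus_distrib_mat[of _ d d _ d]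
        mult_smult_distrib[of _ d d _ d] mtrace_add[of _ d] mtrace_minus[of _ d] mtrace_smult[of _ d]
        minus_carrier_mat[of _ d d] right_mult_one_mat[of _ d d] tr p mult.commute)
qed

lemma density_projector_prob:
  assumes "density d \<rho>" "projector d P"
  shows "0 \<le> Re (mtrace (\<rho> * P))" "Re (mtrace (\<rho> * P)) \<le> 1"
proof -
  have r: "psd d \<rho>" and tr: "mtrace \<rho> = 1" using assms(1) by (auto simp: density_def)
  note [simp] = psd_carrier[OF r] psd_carrier[OF projector_psd(1)[OF assms(2)]]
  show "0 \<le> Re (mtrace (\<rho> * P))" using mtrace_mult_psd_nonneg[OF r projector_psd(1)[OF assms(2)]] .
  show "Re (mtrace (\<rho> * P)) \<le> 1" using mtrace_mult_psd_nonneg[OF r projector_psd(2)[OF assms(2)]]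
    by (simp add: mult_minus_distrib_mat[of _ d d _ d] mult_carrier_mat[of _ d d] mtrace_minus[of _ d]
        right_mult_one_mat[of _ d d] tr)
qed

definition tensor_tilt :: "nat \<Rightarrow> nat \<Rightarrow> nat \<Rightarrow> complex mat \<Rightarrow> real \<Rightarrow> complex mat" where
  "tensor_tilt d m n P c = kron (tpow (tilt d P (real (min m n) * c / real m)) m)
     (tpow (tilt d P (- (real (min m n) * c / real n))) n)"

lemma psd_tensor_tilt:
  assumes "projector d P"
  shows "psd (d ^ (m + n)) (tensor_tilt d m n P c)"
  unfolding tensor_tilt_def power_add by (intro psd_kron psd_tpow psd_tilt assms)

lemma tensor_tilt_inverse:
  assumes "projector d P"
  shows "tensor_tilt d m n P c * tensor_tilt d m n P (- c) = 1\<^sub>m (d ^ (m + n))"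
proof -
  note c [simp] = psd_carrier[OF psd_tilt[OF assms]] tpow_carrier[OF psd_carrier[OF psd_tilt[OF assms]]]
  show ?thesis
    unfolding tensor_tilt_def using tilt_inverse[OF assms, of "- (real (min m n) * c / real n)"]
    by (simp add: kron_mult[OF c(2) c(2) c(2) c(2)] tpow_mult[OF c(1) c(1)] tilt_inverse[OF assms] tpow_one kron_one power_add)
qed

lemma mtrace_tensor_tilt:
  assumes s: "density d \<sigma>" and r: "density d \<rho>" and P: "projector d P"
  defines "p \<equiv> Re (mtrace (\<sigma> * P))" and "q \<equiv> Re (mtrace (\<rho> * P))"
  shows "mtrace (kron (tpow \<sigma> m) (tpow \<rho> n) * tensor_tilt d m n P c) =
    complex_of_real ((1 - p + p * exp (real (min m n) * c / real m)) ^ m *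
      (1 - q + q * exp (- (real (min m n) * c / real n))) ^ n)"
proof -
  note c = psd_carrier[OF psd_tilt[OF P]]
  note [simp] = tpow_carrier[OF c]
  have [simp]: "\<sigma> \<in> carrier_mat d d" "\<rho> \<in> carrier_mat d d"
    using s r by (auto simp: density_def psd_carrier)
  note mc = mult_carrier_mat[of _ d d, OF _ c]
  have "kron (tpow \<sigma> m) (tpow \<rho> n) * tensor_tilt d m n P c =
      kron (tpow (\<sigma> * tilt d P (real (min m n) * c / real m)) m)
        (tpow (\<rho> * tilt d P (- (real (min m n) * c / real n))) n)"
    unfolding tensor_tilt_def
    by (subst kron_mult[of _ "d ^ m" "d ^ m" _ "d ^ n" "d ^ n" _ "d ^ m" _ "d ^ n"]) (simp_all add: tpow_mult[OF _ c])
  also have "mtrace \<dots> = mtrace (\<sigma> * tilt d P (real (min m n) * c / real m)) ^ m *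
      mtrace (\<rho> * tilt d P (- (real (min m n) * c / real n))) ^ n"
    by (simp add: mtrace_kron[of _ "d ^ m" _ "d ^ n"] mtrace_tpow[of _ d] mc)
  finally show ?thesis
    unfolding mtrace_density_tilt[OF s P] mtrace_density_tilt[OF r P] p_def q_def by simp
qed

section \<open>A dense sequence of projectors\<close>

lemma dense_sequence:
  fixes fs :: "('a \<Rightarrow> real) list"
  assumes "S \<noteq> {}"
  shows "\<exists>xs :: nat \<Rightarrow> 'a. (\<forall>i. xs i \<in> S) \<and>
    (\<forall>x\<in>S. \<forall>e>0. \<exists>i. \<forall>f\<in>set fs. \<bar>f (xs i) - f x\<bar> < e)"
proof -
  define key where "key q x = map (\<lambda>f. \<lfloor>real (Suc q) * f x\<rfloor>) fs" for q x
  define pick where "pick ql = (SOME x. x \<in> S \<and> (snd ql \<in> key (fst ql) ` S \<longrightarrow> key (fst ql) x = snd ql))" for ql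
  have pick: "pick ql \<in> S \<and> (snd ql \<in> key (fst ql) ` S \<longrightarrow> key (fst ql) (pick ql) = snd ql)" for ql
  proof -
    have "\<exists>x. x \<in> S \<and> (snd ql \<in> key (fst ql) ` S \<longrightarrow> key (fst ql) x = snd ql)"
    proof (cases "snd ql \<in> key (fst ql) ` S")
      case True
      then obtain x where "x \<in> S" "snd ql = key (fst ql) x" by (rule imageE)
      then show ?thesis by metis
    next
      case False
      then show ?thesis using assms by (metis ex_in_conv)
    qed
    then show ?thesis unfolding pick_def by (rule someI_ex)
  qed
  show ?thesis
  proof (intro exI[of _ "\<lambda>i. pick (from_nat i)"] conjI allI ballI impI)
    show "pick (from_nat i) \<in> S" for i using pick by blast
    fix x and e :: real assume x: "x \<in> S" and e: "0 < e"
    obtain q where q: "1 / real (Suc q) < e" using nat_approx_posE[OF e] by metis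
    let ?y = "pick (q, key q x)"
    have "key q ?y = key q x" using pick[of "(q, key q x)"] x by simp
    then have fl: "\<lfloor>real (Suc q) * f ?y\<rfloor> = \<lfloor>real (Suc q) * f x\<rfloor>" if "f \<in> set fs" for f
      using that by (simp add: key_def)
    have "\<bar>f ?y - f x\<bar> < e" if "f \<in> set fs" for f
    proof -
      have "\<bar>real (Suc q) * f ?y - real (Suc q) * f x\<bar> < 1" using fl[OF that] by linarith
      then have "real (Suc q) * \<bar>f ?y - f x\<bar> < 1"
        by (simp only: right_diff_distrib[symmetric] abs_mult abs_of_nat)
      then have "\<bar>f ?y - f x\<bar> < 1 / real (Suc q)"
        by (simp add: pos_less_divide_eq mult.commute del: of_nat_Suc)
      with q show ?thesis by simp
    qed
    then show "\<exists>i. \<forall>f\<in>set fs. \<bar>f (pick (from_nat i)) - f x\<bar> < e"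
      by (intro exI[of _ "to_nat (q, key q x)"]) simp
  qed
qed

lemma projector_dense_sequence:
  "\<exists>(Ps :: nat \<Rightarrow> complex mat) (cs :: nat \<Rightarrow> real). (\<forall>i. projector d (Ps i)) \<and>
    (\<forall>P c e. projector d P \<longrightarrow> 0 < e \<longrightarrow> (\<exists>i. \<bar>cs i - c\<bar> < e \<and>
      (\<forall>a<d. \<forall>b<d. \<bar>Re (Ps i $$ (a, b)) - Re (P $$ (a, b))\<bar> < e \<and> \<bar>Im (Ps i $$ (a, b)) - Im (P $$ (a, b))\<bar> < e)))"
proof -
  define S :: "(complex mat \<times> real) set" where "S = {x. projector d (fst x)}"
  define ix where "ix = List.product [0..<d] [0..<d]"
  define fs :: "(complex mat \<times> real \<Rightarrow> real) list" where
    "fs = snd # map (\<lambda>ab x. Re (fst x $$ ab)) ix @ map (\<lambda>ab x. Im (fst x $$ ab)) ix"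
  have "(1\<^sub>m d, 0) \<in> S" by (simp add: S_def projector_def)
  then have "S \<noteq> {}" by blast
  from dense_sequence[OF this, of fs] obtain xs :: "nat \<Rightarrow> complex mat \<times> real" where "(\<forall>i. xs i \<in> S) \<and>
    (\<forall>x\<in>S. \<forall>e>0. \<exists>i. \<forall>f\<in>set fs. \<bar>f (xs i) - f x\<bar> < e)"
    by (rule exE) (rule that)
  note xs = this[THEN conjunct1] this[THEN conjunct2]
  show ?thesis
  proof (intro exI[of _ "\<lambda>i. fst (xs i)"] exI[of _ "\<lambda>i. snd (xs i)"] conjI allI impI)
    show "projector d (fst (xs i))" for i using xs(1) by (simp add: S_def)
    fix P c and e :: real assume P: "projector d P" and e: "0 < e"
    from P have "(P, c) \<in> S" by (simp add: S_def)
    from bspec[OF xs(2) this] e obtain i where i: "\<And>f. f \<in> set fs \<Longrightarrow> \<bar>f (xs i) - f (P, c)\<bar> < e"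
      by blast
    have "snd \<in> set fs" by (simp add: fs_def)
    moreover have "(\<lambda>x. Re (fst x $$ (a, b))) \<in> set fs" "(\<lambda>x. Im (fst x $$ (a, b))) \<in> set fs" if "a < d" "b < d" for a b
      using that by (auto simp: fs_def ix_def)
    ultimately show "\<exists>i. \<bar>snd (xs i) - c\<bar> < e \<and> (\<forall>a<d. \<forall>b<d. \<bar>Re (fst (xs i) $$ (a, b)) - Re (P $$ (a, b))\<bar> < e \<and>
        \<bar>Im (fst (xs i) $$ (a, b)) - Im (P $$ (a, b))\<bar> < e)"
      using i by (intro exI[of _ i]) fastforce
  qed
qed

lemma near_optimal_projector:
  assumes dens: "density d \<rho>" "density d \<sigma>" "\<rho> \<noteq> \<sigma>"
    and Ps: "\<And>i. projector d (Ps i)"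
    and dense: "\<And>P c e. projector d P \<Longrightarrow> 0 < e \<Longrightarrow> \<exists>i. \<bar>cs i - c\<bar> < e \<and>
      (\<forall>a<d. \<forall>b<d. \<bar>Re (Ps i $$ (a, b)) - Re (P $$ (a, b))\<bar> < e \<and> \<bar>Im (Ps i $$ (a, b)) - Im (P $$ (a, b))\<bar> < e)"
  shows "\<exists>i :: nat. exp ((cs i)\<^sup>2 / 4) * ((1 - Re (mtrace (\<sigma> * Ps i)) + Re (mtrace (\<sigma> * Ps i)) * exp (- cs i)) *
      (1 - Re (mtrace (\<rho> * Ps i)) + Re (mtrace (\<rho> * Ps i)) * exp (cs i))) < exp (- ((trace_norm (\<rho> - \<sigma>))\<^sup>2 / 8))"
proof -
  have c [simp]: "\<rho> \<in> carrier_mat d d" "\<sigma> \<in> carrier_mat d d"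
    using dens by (auto simp: density_def psd_carrier)
  have X: "\<rho> - \<sigma> \<in> carrier_mat d d" using minus_carrier_mat[OF c(2)] .
  have aX: "adj (\<rho> - \<sigma>) = \<rho> - \<sigma>" using dens by (simp add: adj_minus[of _ d d] density_def psd_def)
  have X0: "\<rho> - \<sigma> \<noteq> 0\<^sub>m d d"
  proof
    assume eq: "\<rho> - \<sigma> = 0\<^sub>m d d"
    have "\<rho> = (\<rho> - \<sigma>) + \<sigma>"
      by (intro eq_matI) (auto simp: carrier_matD[OF c(1)] carrier_matD[OF c(2)])
    then show False using dens(3) by (simp add: eq)
  qed
  obtain P where P: "projector d P"
    and tn: "trace_norm (\<rho> - \<sigma>) = Re (mtrace (\<rho> - \<sigma>)) - 2 * Re (mtrace ((\<rho> - \<sigma>) * P))"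
    using trace_norm_projector[OF X aX] by metis
  have Pc [simp]: "P \<in> carrier_mat d d" using P by (simp add: projector_def)
  define p where "p = Re (mtrace (\<sigma> * P))"
  define q where "q = Re (mtrace (\<rho> * P))"
  define \<delta> where "\<delta> = p - q"
  have tn2: "trace_norm (\<rho> - \<sigma>) = 2 * \<delta>"
    using dens tn by (simp add: density_def mtrace_minus[of _ d] minus_mult_distrib_mat[of _ d d _ _ d]
        mult_carrier_mat[of _ d d] \<delta>_def p_def q_def)
  have \<delta>: "0 < \<delta>" using trace_norm_pos[OF X aX X0] tn2 by simp
  have p: "0 \<le> p" "p \<le> 1" and q: "0 \<le> q" "q \<le> 1"
    using density_projector_prob[OF _ P] dens by (auto simp: p_def q_def)
  have "exp (\<delta>\<^sup>2 / 4) * ((1 - p + p * exp (- \<delta>)) * (1 - q + q * exp \<delta>))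
      < exp (\<delta>\<^sup>2 / 4) * (exp (p * (- \<delta>) + (- \<delta>)\<^sup>2 / 8) * exp (q * \<delta> + \<delta>\<^sup>2 / 8))"
    using bernoulli_mgf_less[OF p, of "- \<delta>"] bernoulli_mgf_less[OF q, of \<delta>]
      bernoulli_mgf_pos[OF p, of "- \<delta>"] bernoulli_mgf_pos[OF q, of \<delta>] \<delta>
    by (intro mult_strict_left_mono mult_strict_mono) (auto intro: less_imp_le)
  also have "\<dots> = exp (- ((trace_norm (\<rho> - \<sigma>))\<^sup>2 / 8))"
  proof -
    have "\<delta>\<^sup>2 / 4 + (p * (- \<delta>) + (- \<delta>)\<^sup>2 / 8 + (q * \<delta> + \<delta>\<^sup>2 / 8)) = - ((2 * \<delta>)\<^sup>2 / 8)"
      by (simp add: \<delta>_def power2_eq_square field_simps)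
    then show ?thesis unfolding tn2 exp_add[symmetric] by simp
  qed
  finally have less: "exp (\<delta>\<^sup>2 / 4) * ((1 - p + p * exp (- \<delta>)) * (1 - q + q * exp \<delta>))
      < exp (- ((trace_norm (\<rho> - \<sigma>))\<^sup>2 / 8))" .
  have "\<exists>i. \<bar>cs i - \<delta>\<bar> < 1 / real (Suc k) \<and> (\<forall>a<d. \<forall>b<d. \<bar>Re (Ps i $$ (a, b)) - Re (P $$ (a, b))\<bar> < 1 / real (Suc k) \<and>
      \<bar>Im (Ps i $$ (a, b)) - Im (P $$ (a, b))\<bar> < 1 / real (Suc k))" for k
    using dense[OF P] by simp
  then obtain I where I: "\<bar>cs (I k) - \<delta>\<bar> < 1 / real (Suc k)"
      "a < d \<Longrightarrow> b < d \<Longrightarrow> \<bar>Re (Ps (I k) $$ (a, b)) - Re (P $$ (a, b))\<bar> < 1 / real (Suc k)"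
      "a < d \<Longrightarrow> b < d \<Longrightarrow> \<bar>Im (Ps (I k) $$ (a, b)) - Im (P $$ (a, b))\<bar> < 1 / real (Suc k)" for k a b
    by metis
  have lim: "f \<longlonglongrightarrow> l" if "\<And>k. \<bar>f k - l\<bar> < 1 / real (Suc k)" for f :: "nat \<Rightarrow> real" and l
  proof (rule tendsto_dist_iff[THEN iffD2], rule tendsto_sandwich[OF _ _ tendsto_const LIMSEQ_Suc[OF lim_1_over_n]])
    show "\<forall>\<^sub>F k in sequentially. dist (f k) l \<le> 1 / of_nat (Suc k)"
      by (intro always_eventually allI less_imp_le) (simp only: dist_real_def that)
  qed auto
  have entry: "(\<lambda>k. Ps (I k) $$ (a, b)) \<longlonglongrightarrow> P $$ (a, b)" if "a < d" "b < d" for a b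
    using I(2,3)[OF that] by (subst tendsto_complex_iff) (auto intro!: lim)
  have tr: "(\<lambda>k. Re (mtrace (A * Ps (I k)))) \<longlonglongrightarrow> Re (mtrace (A * P))" if A: "A \<in> carrier_mat d d" for A
  proof -
    have Pi: "Ps i \<in> carrier_mat d d" for i using Ps by (simp add: projector_def)
    show ?thesis unfolding mtrace_mult_expand[OF A Pc] mtrace_mult_expand[OF A Pi]
      by (intro tendsto_Re tendsto_sum tendsto_mult_left entry) auto
  qed
  have lims: "(\<lambda>k. Re (mtrace (\<sigma> * Ps (I k)))) \<longlonglongrightarrow> p" "(\<lambda>k. Re (mtrace (\<rho> * Ps (I k)))) \<longlonglongrightarrow> q"
    "(\<lambda>k. cs (I k)) \<longlonglongrightarrow> \<delta>"
    unfolding p_def q_def by (rule tr[OF c(2)], rule tr[OF c(1)], rule lim[OF I(1)])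
  have "(\<lambda>k. exp ((cs (I k))\<^sup>2 / 4) * ((1 - Re (mtrace (\<sigma> * Ps (I k))) + Re (mtrace (\<sigma> * Ps (I k))) * exp (- cs (I k))) *
      (1 - Re (mtrace (\<rho> * Ps (I k))) + Re (mtrace (\<rho> * Ps (I k))) * exp (cs (I k)))))
    \<longlonglongrightarrow> exp (\<delta>\<^sup>2 / 4) * ((1 - p + p * exp (- \<delta>)) * (1 - q + q * exp \<delta>))"
    by (intro tendsto_intros lims) simp_all
  from order_tendstoD(2)[OF this less] show ?thesis
    unfolding eventually_sequentially by blast
qed

theorem theorem7:
  fixes d :: nat and \<alpha> :: real
  assumes "1 \<le> d" and "0 < \<alpha>" and "\<alpha> < 1"
  shows "\<exists>M :: nat \<Rightarrow> nat \<Rightarrow> complex mat \<times> complex mat.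
    (\<forall>m n. povm2 (d ^ (m + n)) (fst (M m n)) (snd (M m n))) \<and>
    (\<forall>C :: real. \<exists>N :: nat. \<forall>m n. N \<le> m \<and> N \<le> n \<and> real m \<le> C * real n \<and> real n \<le> C * real m \<longrightarrow>
        (\<forall>\<rho>. density d \<rho> \<longrightarrow>
           Re (mtrace (kron (tpow \<rho> m) (tpow \<rho> n) * snd (M m n))) \<le> \<alpha>)) \<and>
    (\<forall>\<rho> \<sigma>. density d \<rho> \<longrightarrow> density d \<sigma> \<longrightarrow> \<rho> \<noteq> \<sigma> \<longrightarrow>
       (\<forall>C :: real. \<exists>K :: real. \<exists>N :: nat. \<forall>m n.
          N \<le> m \<and> N \<le> n \<and> real m \<le> C * real n \<and> real n \<le> C * real m \<longrightarrow>
          Re (mtrace (kron (tpow \<sigma> m) (tpow \<rho> n) * fst (M m n)))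
            \<le> exp (- (real (min m n) * (trace_norm (\<rho> - \<sigma>))\<^sup>2 / 8) + K * sqrt (real (min m n)))))"
proof -
  obtain Ps :: "nat \<Rightarrow> complex mat" and cs :: "nat \<Rightarrow> real" where Ps: "\<And>i. projector d (Ps i)"
    and dense: "\<And>P c e. projector d P \<Longrightarrow> 0 < e \<Longrightarrow> \<exists>i. \<bar>cs i - c\<bar> < e \<and>
      (\<forall>a<d. \<forall>b<d. \<bar>Re (Ps i $$ (a, b)) - Re (P $$ (a, b))\<bar> < e \<and> \<bar>Im (Ps i $$ (a, b)) - Im (P $$ (a, b))\<bar> < e)"
    using projector_dense_sequence[of d] by metis
  define F where "F m n i = complex_of_real (exp (- (real (min m n) * (cs i)\<^sup>2 / 4))) \<cdot>\<^sub>m tensor_tilt d m n (Ps i) (cs i)"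
    for m n i
  define F' where "F' m n i = complex_of_real (exp (real (min m n) * (cs i)\<^sup>2 / 4)) \<cdot>\<^sub>m tensor_tilt d m n (Ps i) (- cs i)"
    for m n i
  have F: "psd (d ^ (m + n)) (F m n i)" "psd (d ^ (m + n)) (F' m n i)" for m n i
    unfolding F_def F'_def by (intro psd_smult psd_tensor_tilt Ps; simp)+
  have FF': "F m n i * F' m n i = 1\<^sub>m (d ^ (m + n))" for m n i
  proof -
    note T = psd_carrier[OF psd_tensor_tilt[OF Ps[of i], of m n]]
    have "F m n i * F' m n i = complex_of_real (exp (- (real (min m n) * (cs i)\<^sup>2 / 4)) * exp (real (min m n) * (cs i)\<^sup>2 / 4)) \<cdot>\<^sub>m
        1\<^sub>m (d ^ (m + n))"
      unfolding F_def F'_def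
      unfolding mult_smult_assoc_mat[OF T smult_carrier_mat[OF T]] mult_smult_distrib[OF T T] tensor_tilt_inverse[OF Ps]
      by (intro eq_matI) auto
    moreover have "1 \<cdot>\<^sub>m A = A" for A :: "complex mat" by (intro eq_matI) auto
    ultimately show ?thesis by (simp flip: exp_add)
  qed
  define W where "W m n = msum (d ^ (m + n)) (F m n) (Suc (min m n))" for m n
  define \<kappa> where "\<kappa> k = real (Suc k) / \<alpha>" for k
  have \<kappa>: "0 < \<kappa> k" for k using assms by (simp add: \<kappa>_def)
  have W: "psd (d ^ (m + n)) (W m n)" for m n unfolding W_def by (intro psd_msum F)
  define M where "M m n = (SOME E. resolvent_test (d ^ (m + n)) (W m n) (\<kappa> (min m n)) E)" for m n
  have M: "resolvent_test (d ^ (m + n)) (W m n) (\<kappa> (min m n)) (M m n)" for m n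
    unfolding M_def by (rule someI_ex[OF resolvent_test_exists[OF W \<kappa>]])
  have povm: "povm2 (d ^ (m + n)) (fst (M m n)) (snd (M m n))" for m n
    using M[of m n] unfolding resolvent_test_def by blast
  have I: "Re (mtrace (X * snd (M m n))) \<le> Re (mtrace (X * W m n)) / \<kappa> (min m n)"
    if "psd (d ^ (m + n)) X" for m n X
    using M[of m n] that unfolding resolvent_test_def by blast
  have II: "Re (mtrace (X * fst (M m n))) \<le> \<kappa> (min m n) * Re (mtrace (X * V'))"
    if "psd (d ^ (m + n)) X" "psd (d ^ (m + n)) V" "psd (d ^ (m + n)) V'" "V * V' = 1\<^sub>m (d ^ (m + n))"
      "psd (d ^ (m + n)) (W m n - V)" for m n X V V'
    using M[of m n] that unfolding resolvent_test_def by blast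
  have prod: "psd (d ^ (m + n)) (kron (tpow \<sigma> m) (tpow \<rho> n))" if "density d \<sigma>" "density d \<rho>" for \<sigma> \<rho> m n
    unfolding power_add using that by (intro psd_kron psd_tpow) (auto simp: density_def)
  have typeI: "Re (mtrace (kron (tpow \<rho> m) (tpow \<rho> n) * snd (M m n))) \<le> \<alpha>" if \<rho>: "density d \<rho>" for \<rho> m n
  proof -
    let ?X = "kron (tpow \<rho> m) (tpow \<rho> n)"
    have "Re (mtrace (?X * F m n i)) \<le> 1" for i
    proof -
      define p where "p = Re (mtrace (\<rho> * Ps i))"
      note X = psd_carrier[OF prod[OF \<rho> \<rho>, of m n]]
      note T = psd_carrier[OF psd_tensor_tilt[OF Ps[of i], of m n]]
      have "Re (mtrace (?X * F m n i)) = exp (- (real (min m n) * (cs i)\<^sup>2 / 4)) *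
          ((1 - p + p * exp (real (min m n) * cs i / real m)) ^ m * (1 - p + p * exp (- (real (min m n) * cs i / real n))) ^ n)"
        unfolding F_def mult_smult_distrib[OF X T] mtrace_smult[OF mult_carrier_mat[OF X T]]
          mtrace_tensor_tilt[OF \<rho> \<rho> Ps] p_def of_real_mult[symmetric] Re_complex_of_real by simp
      also have "\<dots> \<le> 1"
        using density_projector_prob[OF \<rho> Ps] by (intro bernoulli_product_le_one) (auto simp: p_def)
      finally show ?thesis .
    qed
    then have "(\<Sum>i<Suc (min m n). Re (mtrace (?X * F m n i))) \<le> (\<Sum>i<Suc (min m n). 1)"
      by (intro sum_mono)
    then have "Re (mtrace (?X * W m n)) \<le> real (Suc (min m n))"
      unfolding W_def
      by (subst mtrace_msum) (use psd_carrier[OF prod[OF \<rho> \<rho>]] psd_carrier[OF F(1)] in simp_all)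
    then have "Re (mtrace (?X * W m n)) / \<kappa> (min m n) \<le> real (Suc (min m n)) / \<kappa> (min m n)"
      using \<kappa> by (intro divide_right_mono) (auto intro: less_imp_le)
    also have "\<dots> = \<alpha>" by (simp add: \<kappa>_def)
    finally show ?thesis using I[OF prod[OF \<rho> \<rho>]] by (rule order_trans[rotated])
  qed
  have typeII: "\<exists>N. \<forall>m n. N \<le> m \<and> N \<le> n \<longrightarrow> Re (mtrace (kron (tpow \<sigma> m) (tpow \<rho> n) * fst (M m n)))
      \<le> exp (- (real (min m n) * (trace_norm (\<rho> - \<sigma>))\<^sup>2 / 8))"
    if \<rho>: "density d \<rho>" and \<sigma>: "density d \<sigma>" and ne: "\<rho> \<noteq> \<sigma>" for \<rho> \<sigma>
  proof -
    define b where "b = exp (- ((trace_norm (\<rho> - \<sigma>))\<^sup>2 / 8))"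
    define p where "p i = Re (mtrace (\<sigma> * Ps i))" for i
    define q where "q i = Re (mtrace (\<rho> * Ps i))" for i
    have p: "0 \<le> p i" "p i \<le> 1" and q: "0 \<le> q i" "q i \<le> 1" for i
      using density_projector_prob[OF _ Ps] \<rho> \<sigma> by (auto simp: p_def q_def)
    define r where "r i = exp ((cs i)\<^sup>2 / 4) * ((1 - p i + p i * exp (- cs i)) * (1 - q i + q i * exp (cs i)))" for i
    obtain i where i: "r i < b"
      using near_optimal_projector[OF \<rho> \<sigma> ne Ps dense] unfolding b_def r_def p_def q_def by metis
    have r0: "0 \<le> r i" unfolding r_def using bernoulli_mgf_pos[OF p, of i] bernoulli_mgf_pos[OF q, of i]
      by (intro mult_nonneg_nonneg) (auto intro: less_imp_le)
    obtain N where N: "\<And>k. N \<le> k \<Longrightarrow> real (Suc k) / \<alpha> * r i ^ k \<le> b ^ k"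
      using eventually_mult_power_le[OF r0 i assms(2)] by blast
    show ?thesis
    proof (intro exI[of _ "max N i"] allI impI)
      fix m n assume mn: "max N i \<le> m \<and> max N i \<le> n"
      let ?k = "min m n" and ?X = "kron (tpow \<sigma> m) (tpow \<rho> n)"
      note X = psd_carrier[OF prod[OF \<sigma> \<rho>, of m n]]
      note T = psd_carrier[OF psd_tensor_tilt[OF Ps[of i], of m n]]
      have "psd (d ^ (m + n)) (W m n - F m n i)"
        unfolding W_def using mn by (intro psd_msum_minus F) auto
      from II[OF prod[OF \<sigma> \<rho>] F(1,2) FF' this]
      have "Re (mtrace (?X * fst (M m n))) \<le> \<kappa> ?k * Re (mtrace (?X * F' m n i))" .
      also have "Re (mtrace (?X * F' m n i)) = exp (real ?k * (cs i)\<^sup>2 / 4) *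
          ((1 - p i + p i * exp (real ?k * (- cs i) / real m)) ^ m * (1 - q i + q i * exp (- (real ?k * (- cs i) / real n))) ^ n)"
        unfolding F'_def mult_smult_distrib[OF X T] mtrace_smult[OF mult_carrier_mat[OF X T]]
          mtrace_tensor_tilt[OF \<sigma> \<rho> Ps] p_def q_def of_real_mult[symmetric] Re_complex_of_real by simp
      also have "\<kappa> ?k * \<dots> \<le> \<kappa> ?k * (exp (real ?k * (cs i)\<^sup>2 / 4) *
          ((1 - p i + p i * exp (- cs i)) ^ ?k * (1 - q i + q i * exp (cs i)) ^ ?k))"
      proof -
        have "(1 - p i + p i * exp (real ?k * (- cs i) / real m)) ^ m \<le> (1 - p i + p i * exp (- cs i)) ^ ?k"
          using p by (intro bernoulli_mgf_power_le) auto
        moreover have "(1 - q i + q i * exp (- (real ?k * (- cs i) / real n))) ^ n \<le> (1 - q i + q i * exp (cs i)) ^ ?k"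
          using bernoulli_mgf_power_le[OF q, of ?k n i "cs i"] by simp
        ultimately show ?thesis
          using \<kappa>[of ?k] bernoulli_mgf_pos[OF p, of i] bernoulli_mgf_pos[OF q, of i]
          by (intro mult_left_mono mult_mono) (auto intro!: less_imp_le)
      qed
      also have "\<dots> = real (Suc ?k) / \<alpha> * r i ^ ?k"
        by (simp add: \<kappa>_def r_def power_mult_distrib flip: exp_of_nat_mult)
      also have "\<dots> \<le> b ^ ?k" using mn by (intro N) auto
      also have "\<dots> = exp (- (real ?k * (trace_norm (\<rho> - \<sigma>))\<^sup>2 / 8))"
        by (simp add: b_def flip: exp_of_nat_mult)
      finally show "Re (mtrace (?X * fst (M m n))) \<le> exp (- (real ?k * (trace_norm (\<rho> - \<sigma>))\<^sup>2 / 8))" .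
    qed
  qed
  show ?thesis
  proof (intro exI[of _ M] conjI allI impI)
    show "povm2 (d ^ (m + n)) (fst (M m n)) (snd (M m n))" for m n by (rule povm)
    show "\<exists>N. \<forall>m n. N \<le> m \<and> N \<le> n \<and> real m \<le> C * real n \<and> real n \<le> C * real m \<longrightarrow>
        (\<forall>\<rho>. density d \<rho> \<longrightarrow> Re (mtrace (kron (tpow \<rho> m) (tpow \<rho> n) * snd (M m n))) \<le> \<alpha>)" for C
      using typeI by blast
    fix \<rho> \<sigma> C assume "density d \<rho>" "density d \<sigma>" "\<rho> \<noteq> \<sigma>"
    from typeII[OF this] obtain N where "\<forall>m n. N \<le> m \<and> N \<le> n \<longrightarrow>
        Re (mtrace (kron (tpow \<sigma> m) (tpow \<rho> n) * fst (M m n))) \<le> exp (- (real (min m n) * (trace_norm (\<rho> - \<sigma>))\<^sup>2 / 8))"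
      by blast
    then show "\<exists>K N. \<forall>m n. N \<le> m \<and> N \<le> n \<and> real m \<le> C * real n \<and> real n \<le> C * real m \<longrightarrow>
        Re (mtrace (kron (tpow \<sigma> m) (tpow \<rho> n) * fst (M m n)))
          \<le> exp (- (real (min m n) * (trace_norm (\<rho> - \<sigma>))\<^sup>2 / 8) + K * sqrt (real (min m n)))"
      by (intro exI[of _ 0] exI[of _ N]) simp
  qed
qed

end
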